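(* For $k=0,1,\dots,n$, $$\upsilon_k(\mathcal{C}(A_{n-1}))=\frac{1}{n!}\left[{n\atop k}\right],\qquad \upsilon_k(\mathcal{C}(B_n))=\frac{B(n,k)}{2^nn!},\qquad \upsilon_k(\mathcal{C}(D_n))=\frac{D(n,k)}{2^{n-1}n!}.$$
   Context: Weyl chambers in $\mathbb{R}^n$: $\mathcal{C}(A_{n-1})=\{x:x_1<x_2<\dots<x_n\}$, $\mathcal{C}(B_n)=\{x:0<x_1<\dots<x_n\}$, $\mathcal{C}(D_n)=\{x:0<|x_1|<x_2<\dots<x_n\}$. Conic intrinsic volumes $\upsilon_0(C),\dots,\upsilon_n(C)$ of a convex cone $C\subset\mathbb{R}^n$ (here applied to the closure) are the unique numbers such that for all $\lambda\ge0$, $\mathbb{P}[\mathrm{dist}^2(\theta,\bar C)\le\lambda]=\sum_{k=0}^n\beta_{k,n}(\lambda)\upsilon_k(C)$, where $\theta$ is uniform on the unit sphere $S^{n-1}$ and $\beta_{k,n}$ is the distribution function of the Beta distribution with parameters $(n-k)/2$ and $n/2$. The numbers are defined by $t(t+1)\cdots(t+n-1)=\sum_k\left[{n\atop k}\right]t^k$, $(t+1)(t+3)\cdots(t+2n-1)=\sum_kB(n,k)t^k$, $(t+1)(t+3)\cdots(t+2n-3)(t+n-1)=\sum_kD(n,k)t^k$, with value $0$ for exponents not appearing.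
   Formalization: The Beta distribution in the definition of the conic intrinsic volumes has parameters (n-k)/2 and k/2 (not n/2, for which the numbers do not exist, e.g. for C(A_1)); types A and B are stated for n ≥ 1 and type D for n ≥ 2. *)

theory Defs
  imports "HOL-Probability.Probability" "HOL-Combinatorics.Stirling"
          "HOL-Computational_Algebra.Polynomial"
begin

text \<open>R^n is modelled as the extensional functions nat => real supported on {..<n}
  (coordinates x_1..x_n correspond to x 0 .. x (n-1)).\<close>

definition eucl_dist :: "nat \<Rightarrow> (nat \<Rightarrow> real) \<Rightarrow> (nat \<Rightarrow> real) \<Rightarrow> real" where
  "eucl_dist n x y = sqrt (\<Sum>i<n. (x i - y i)^2)"

definition eucl_norm :: "nat \<Rightarrow> (nat \<Rightarrow> real) \<Rightarrow> real" where
  "eucl_norm n x = sqrt (\<Sum>i<n. (x i)^2)"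

definition dist2_closure :: "nat \<Rightarrow> (nat \<Rightarrow> real) set \<Rightarrow> (nat \<Rightarrow> real) \<Rightarrow> real" where
  "dist2_closure n C x = (INF y\<in>closure C. (eucl_dist n x y)^2)"

text \<open>Standard Gaussian vector in R^n; theta = g / |g| is uniform on the unit sphere.\<close>
definition gauss :: "nat \<Rightarrow> (nat \<Rightarrow> real) measure" where
  "gauss n = PiM {..<n} (\<lambda>_. density lborel (\<lambda>x. ennreal (std_normal_density x)))"

definition sphere_normalize :: "nat \<Rightarrow> (nat \<Rightarrow> real) \<Rightarrow> (nat \<Rightarrow> real)" where
  "sphere_normalize n g = restrict (\<lambda>i. g i / eucl_norm n g) {..<n}"

definition dist_cdf :: "nat \<Rightarrow> (nat \<Rightarrow> real) set \<Rightarrow> real \<Rightarrow> real" where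
  "dist_cdf n C lam = measure (gauss n)
     {g \<in> space (gauss n). eucl_norm n g \<noteq> 0 \<and>
        dist2_closure n C (sphere_normalize n g) \<le> lam}"

definition beta_cdf :: "real \<Rightarrow> real \<Rightarrow> real \<Rightarrow> real" where
  "beta_cdf a b lam =
     (if a = 0 then (if 0 \<le> lam then 1 else 0)
      else if b = 0 then (if 1 \<le> lam then 1 else 0)
      else if lam \<le> 0 then 0
      else (LBINT t=0..min lam 1. t powr (a - 1) * (1 - t) powr (b - 1)) / Beta a b)"

definition beta_kn :: "nat \<Rightarrow> nat \<Rightarrow> real \<Rightarrow> real" where
  "beta_kn k n lam = beta_cdf ((real n - real k) / 2) (real k / 2) lam"

definition conic_intrinsic_volume :: "nat \<Rightarrow> (nat \<Rightarrow> real) set \<Rightarrow> nat \<Rightarrow> real" where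
  "conic_intrinsic_volume n C = (THE v. (\<forall>k>n. v k = 0) \<and>
      (\<forall>lam\<ge>0. dist_cdf n C lam = (\<Sum>k\<le>n. beta_kn k n lam * v k)))"

definition weyl_A :: "nat \<Rightarrow> (nat \<Rightarrow> real) set" where
  "weyl_A n = {x \<in> PiE {..<n} (\<lambda>_. UNIV). \<forall>i. Suc i < n \<longrightarrow> x i < x (Suc i)}"

definition weyl_B :: "nat \<Rightarrow> (nat \<Rightarrow> real) set" where
  "weyl_B n = {x \<in> PiE {..<n} (\<lambda>_. UNIV). 0 < x 0 \<and> (\<forall>i. Suc i < n \<longrightarrow> x i < x (Suc i))}"

definition weyl_D :: "nat \<Rightarrow> (nat \<Rightarrow> real) set" where
  "weyl_D n = {x \<in> PiE {..<n} (\<lambda>_. UNIV). 0 < \<bar>x 0\<bar> \<and>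
      (\<forall>i. Suc i < n \<longrightarrow> (if i = 0 then \<bar>x 0\<bar> < x 1 else x i < x (Suc i)))}"

definition B_num :: "nat \<Rightarrow> nat \<Rightarrow> nat" where
  "B_num n k = coeff (\<Prod>i<n. [:2*i+1, 1:]) k"

definition D_num :: "nat \<Rightarrow> nat \<Rightarrow> nat" where
  "D_num n k = coeff ((\<Prod>i<n-1. [:2*i+1, 1:]) * [:n-1, 1:]) k"

end

theory Submission
  imports Defs
begin

text \<open>Cutting a convex set \<open>C\<close> by a hyperplane into halves \<open>C\<^sub>+\<close>, \<open>C\<^sub>-\<close> with common wall \<open>C\<^sub>0\<close>, one has
  \<open>f(d(x,C)) + f(d(x,C\<^sub>0)) = f(d(x,C\<^sub>+)) + f(d(x,C\<^sub>-))\<close> for every point \<open>x\<close> and every function \<open>f\<close> of the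
  distance. Adding the hyperplanes of a reflection arrangement one coordinate at a time therefore yields a
  pointwise identity: the sum of \<open>f(d(x,C))\<close> over all chambers \<open>C\<close> equals the sum of \<open>f(d(x,L))\<close> over all
  flats \<open>L\<close>, with multiplicities whose generating function by dimension is the product of the factors
  \<open>t + h\<close>, where \<open>h\<close> is the number of hyperplanes added in a step. Integrating over a Gaussian vector, all
  chambers contribute equally by symmetry, and a flat of dimension \<open>k\<close> contributes the beta distribution
  with parameters \<open>(n - k)/2\<close> and \<open>k/2\<close>. These distributions are linearly independent. The chamber of
  type D is cut by \<open>x\<^sub>1 = 0\<close> into two chambers of type B, with a wall that is a chamber of type B in
  dimension \<open>n - 1\<close>.\<close>

section \<open>Distances to convex cones cut by a hyperplane\<close>

text \<open>The function \<open>f\<close> can be arbitrary because two of the four distances are the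
  minimum and the maximum of the other two, so both sides evaluate \<open>f\<close> at the same pair
  of numbers. Overlaps of chambers along walls are thereby counted exactly at every point, and no
  null sets enter the combinatorics. The induction over coordinates forces a relative form, with
  everything intersected with a pointed convex set \<open>V\<close>: the hyperplanes of a later
  coordinate pass into \<open>V\<close> while the chambers of the earlier ones are summed. Cones
  consist of arbitrary functions \<open>nat => real\<close>, of which the distance reads the
  coordinates below \<open>n\<close>; arrangements in fewer coordinates then share one ambient space
  with the full one. The given chambers consist of extensional functions and are tested on the
  sphere, so a bridge is needed: for a cone, \<open>dist^2 <= lam\<close> at \<open>g / |g|\<close>
  means \<open>dist^2 <= lam * |g|^2\<close> at \<open>g\<close>. That the law for a flat depends on
  its dimension only is rotation invariance; in place of orthonormal bases, at most one plane
  reflection per hyperplane carries the flat to a coordinate subspace.\<close>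

definition dist2 :: "nat \<Rightarrow> (nat \<Rightarrow> real) set \<Rightarrow> (nat \<Rightarrow> real) \<Rightarrow> real" where
  "dist2 n C x = (INF y\<in>C. \<Sum>i<n. (x i - y i)\<^sup>2)"

lemma eucl_dist_sq: "(eucl_dist n x y)\<^sup>2 = (\<Sum>i<n. (x i - y i)\<^sup>2)"
  by (simp add: eucl_dist_def sum_nonneg)

lemma eucl_norm_sq: "(eucl_norm n x)\<^sup>2 = (\<Sum>i<n. (x i)\<^sup>2)"
  by (simp add: eucl_norm_def sum_nonneg)

lemma bdd_below_dist2 [simp]: "bdd_below ((\<lambda>y. \<Sum>i<n. (x i - y i)\<^sup>2 :: real) ` C)"
  by (rule bdd_belowI2[where m = 0]) (simp add: sum_nonneg)

lemma dist2_lower: "y \<in> C \<Longrightarrow> dist2 n C x \<le> (\<Sum>i<n. (x i - y i)\<^sup>2)"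
  unfolding dist2_def by (rule cINF_lower) auto

lemma dist2_greatest:
  "C \<noteq> {} \<Longrightarrow> (\<And>y. y \<in> C \<Longrightarrow> m \<le> (\<Sum>i<n. (x i - y i)\<^sup>2)) \<Longrightarrow> m \<le> dist2 n C x"
  unfolding dist2_def by (rule cINF_greatest)

lemma dist2_antimono: "C \<noteq> {} \<Longrightarrow> C \<subseteq> C' \<Longrightarrow> dist2 n C' x \<le> dist2 n C x"
  by (rule dist2_greatest) (auto intro: dist2_lower)

lemma dist2_Un:
  assumes "A \<noteq> {}" "B \<noteq> {}"
  shows "dist2 n (A \<union> B) x = min (dist2 n A x) (dist2 n B x)"
  unfolding dist2_def using assms by (subst cINF_union) (auto simp: inf_min)

definition segment_point :: "real \<Rightarrow> (nat \<Rightarrow> real) \<Rightarrow> (nat \<Rightarrow> real) \<Rightarrow> nat \<Rightarrow> real" where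
  "segment_point t p q = (\<lambda>i. (1 - t) * p i + t * q i)"

text \<open>The origin lies on every hyperplane of a reflection arrangement, so requiring it keeps
  halves and walls nonempty, as the infima in \<open>dist2\<close> demand; convexity supplies the
  crossing points of segments.\<close>

definition pointed_convex :: "(nat \<Rightarrow> real) set \<Rightarrow> bool" where
  "pointed_convex C \<longleftrightarrow> (\<lambda>_. 0) \<in> C \<and>
     (\<forall>p\<in>C. \<forall>q\<in>C. \<forall>t. 0 \<le> t \<longrightarrow> t \<le> 1 \<longrightarrow> segment_point t p q \<in> C)"

lemma pointed_convex_Int: "pointed_convex A \<Longrightarrow> pointed_convex B \<Longrightarrow> pointed_convex (A \<inter> B)"
  by (auto simp: pointed_convex_def)

lemma pointed_convex_UNIV [simp]: "pointed_convex UNIV"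
  by (auto simp: pointed_convex_def)

text \<open>Convexity of the squared distance to \<open>x\<close>, weakened to a maximum: where a
  segment crosses a hyperplane it is no farther from \<open>x\<close> than the farther of its
  endpoints.\<close>

lemma segment_bound:
  assumes "0 \<le> t" "t \<le> 1"
  shows "(\<Sum>i<n. (x i - segment_point t p q i)\<^sup>2) \<le>
     max (\<Sum>i<n. (x i - p i)\<^sup>2) (\<Sum>i<n. (x i - q i)\<^sup>2)" (is "?L \<le> max ?P ?Q")
proof -
  have sq: "(a - ((1 - t) * b + t * c))\<^sup>2 \<le> (1 - t) * (a - b)\<^sup>2 + t * (a - c)\<^sup>2" for a b c :: real
  proof -
    have "(1 - t) * (a - b)\<^sup>2 + t * (a - c)\<^sup>2 - (a - ((1 - t) * b + t * c))\<^sup>2 = t * (1 - t) * (b - c)\<^sup>2"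
      by (simp add: algebra_simps power2_eq_square)
    moreover have "0 \<le> t * (1 - t) * (b - c)\<^sup>2" using assms by simp
    ultimately show ?thesis by linarith
  qed
  have "?L \<le> (\<Sum>i<n. (1 - t) * (x i - p i)\<^sup>2 + t * (x i - q i)\<^sup>2)"
    unfolding segment_point_def by (intro sum_mono sq)
  also have "\<dots> = (1 - t) * ?P + t * ?Q" by (simp add: sum.distrib sum_distrib_left)
  also have "\<dots> \<le> (1 - t) * max ?P ?Q + t * max ?P ?Q"
    using assms by (intro add_mono mult_left_mono) auto
  also have "\<dots> = max ?P ?Q" by (simp add: algebra_simps)
  finally show ?thesis .
qed

definition linear_form :: "((nat \<Rightarrow> real) \<Rightarrow> real) \<Rightarrow> bool" where
  "linear_form h \<longleftrightarrow> h (\<lambda>_. 0) = 0 \<and>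
     (\<forall>t p q. h (segment_point t p q) = (1 - t) * h p + t * h q)"

lemma linear_form_scaled_coord [simp]: "linear_form (\<lambda>y. s * y i)"
  by (simp add: linear_form_def segment_point_def algebra_simps)

lemma linear_form_coord [simp]: "linear_form (\<lambda>y. y i)" "linear_form (\<lambda>y. - y i)"
  using linear_form_scaled_coord[of 1] linear_form_scaled_coord[of "-1"] by simp_all

lemma linear_form_zero [simp]: "linear_form (\<lambda>_. 0)"
  using linear_form_scaled_coord[of 0] by simp

lemma pointed_convex_halfspace [simp]:
  assumes "linear_form g" "linear_form h"
  shows "pointed_convex {y. g y \<le> h y}"
  using assms
  by (auto simp: pointed_convex_def linear_form_def intro!: add_mono mult_left_mono)

lemma pointed_convex_hyperplane [simp]:
  "linear_form g \<Longrightarrow> linear_form h \<Longrightarrow> pointed_convex {y. g y = h y}"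
  by (auto simp: pointed_convex_def linear_form_def)

text \<open>The distance to \<open>C\<close> is the smaller, and the distance to the slice by the hyperplane the larger
  of the distances to the two halves: a segment joining the two halves meets the hyperplane.\<close>

lemma dist2_cut:
  fixes f :: "real \<Rightarrow> real"
  assumes C: "pointed_convex C" and g: "linear_form g" and h: "linear_form h"
  shows "f (dist2 n C x) + f (dist2 n (C \<inter> {y. g y = h y}) x) =
    f (dist2 n (C \<inter> {y. g y \<le> h y}) x) + f (dist2 n (C \<inter> {y. h y \<le> g y}) x)"
proof -
  let ?A = "C \<inter> {y. g y \<le> h y}" and ?B = "C \<inter> {y. h y \<le> g y}" and ?Z = "C \<inter> {y. g y = h y}"
  have ne: "?A \<noteq> {}" "?B \<noteq> {}" "?Z \<noteq> {}"
    using C g h by (auto simp: pointed_convex_def linear_form_def intro!: exI[of _ "\<lambda>_. 0"])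
  have "C = ?A \<union> ?B" by auto
  then have C_min: "dist2 n C x = min (dist2 n ?A x) (dist2 n ?B x)"
    using dist2_Un[OF ne(1,2)] by metis
  have key: "dist2 n ?Z x \<le> max (\<Sum>i<n. (x i - p i)\<^sup>2) (\<Sum>i<n. (x i - q i)\<^sup>2)"
    if p: "p \<in> ?A" and q: "q \<in> ?B" for p q
  proof -
    define a b where "a = h p - g p" and "b = g q - h q"
    have ab: "0 \<le> a" "0 \<le> b" using p q by (auto simp: a_def b_def)
    \<comment> \<open>The form \<open>h - g\<close> equals \<open>a\<close> at \<open>p\<close> and
      \<open>- b\<close> at \<open>q\<close>; along the segment it vanishes at
      \<open>t = a / (a + b)\<close>. If \<open>a + b = 0\<close>, both endpoints already lie on the
      hyperplane.\<close>
    obtain t where t: "0 \<le> t" "t \<le> 1" "(1 - t) * a = t * b"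
    proof (cases "a + b = 0")
      case True
      with ab have "a = 0" "b = 0" by auto
      then show ?thesis using that[of 0] by simp
    next
      case False
      with ab have "0 < a + b" by simp
      then show ?thesis using that[of "a / (a + b)"] ab by (simp add: field_simps)
    qed
    have "(1 - t) * g p + t * g q = (1 - t) * h p + t * h q"
      using t(3) by (simp add: a_def b_def algebra_simps)
    then have "g (segment_point t p q) = h (segment_point t p q)"
      using g h by (simp add: linear_form_def)
    moreover have "segment_point t p q \<in> C"
      using t C p q by (auto simp: pointed_convex_def)
    ultimately have "segment_point t p q \<in> ?Z" by simp
    from dist2_lower[OF this] segment_bound[OF t(1,2)] show ?thesis by (rule order_trans)
  qed
  have "dist2 n ?Z x \<le> max (dist2 n ?A x) (dist2 n ?B x)"
  proof (rule ccontr)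
    let ?z = "dist2 n ?Z x"
    assume "\<not> ?thesis"
    then have "dist2 n ?A x < ?z" "dist2 n ?B x < ?z" by auto
    \<comment> \<open>\<open>C\<close> need not be closed and the infima need not be attained; the
      strict inequalities still yield points of both halves nearer than \<open>?z\<close>.\<close>
    then obtain p q where "p \<in> ?A" "(\<Sum>i<n. (x i - p i)\<^sup>2) < ?z"
      "q \<in> ?B" "(\<Sum>i<n. (x i - q i)\<^sup>2) < ?z"
      unfolding dist2_def[of _ ?A] dist2_def[of _ ?B] using ne
      by (subst (asm) (1 2) cINF_less_iff) auto
    with key[of p q] show False by auto
  qed
  moreover have "max (dist2 n ?A x) (dist2 n ?B x) \<le> dist2 n ?Z x"
    by (intro max.boundedI dist2_antimono ne) auto
  ultimately have Z_max: "dist2 n ?Z x = max (dist2 n ?A x) (dist2 n ?B x)" by simp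
  show ?thesis unfolding C_min Z_max by (auto simp: min_def max_def)
qed

text \<open>A pair \<open>(s, i)\<close> stands for the linear form \<open>y \<mapsto> s * y i\<close>; a list of such pairs encodes
  the chain of inequalities between the corresponding forms.\<close>

definition form_val :: "(nat \<Rightarrow> real) \<Rightarrow> real \<times> nat \<Rightarrow> real" where
  "form_val y z = fst z * y (snd z)"

lemma linear_form_val [simp]: "linear_form (\<lambda>y. form_val y z)"
  by (simp add: form_val_def)

definition chain_cone :: "(real \<times> nat) list \<Rightarrow> (nat \<Rightarrow> real) set" where
  "chain_cone zs = {y. sorted (map (form_val y) zs)}"

text \<open>The positions available to a new form in a chain: they correspond to the pieces into
  which the hyperplanes \<open>z = w\<close>, for \<open>w\<close> in the chain, cut the chamber of
  that chain.\<close>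

fun insertions :: "'a \<Rightarrow> 'a list \<Rightarrow> 'a list list" where
  "insertions z [] = [[z]]"
| "insertions z (a # xs) = (z # a # xs) # map ((#) a) (insertions z xs)"

lemma length_insertions [simp]: "length (insertions z xs) = Suc (length xs)"
  by (induction xs) auto

lemma insertions_mset: "ys \<in> set (insertions z xs) \<Longrightarrow> mset ys = add_mset z (mset xs)"
  by (induction xs arbitrary: ys) auto

lemma insertions_set: "ys \<in> set (insertions z xs) \<Longrightarrow> set ys = insert z (set xs)"
  by (drule insertions_mset) (metis set_mset_add_mset_insert set_mset_mset)

lemma pointed_convex_chain_cone [simp]: "pointed_convex (chain_cone zs)"
proof (induction zs)
  case (Cons a zs)
  have "chain_cone (a # zs) = (\<Inter>z\<in>set zs. {y. form_val y a \<le> form_val y z}) \<inter> chain_cone zs"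
    by (auto simp: chain_cone_def)
  moreover have "pointed_convex (\<Inter>z\<in>set zs. {y. form_val y a \<le> form_val y z})"
  proof -
    have "pointed_convex (\<Inter>z\<in>Z. {y. form_val y a \<le> form_val y z})" if "finite Z" for Z
      using that by induction (auto intro!: pointed_convex_Int)
    then show ?thesis by simp
  qed
  ultimately show ?case using Cons by (auto intro: pointed_convex_Int)
qed (auto simp: chain_cone_def)

text \<open>Inside the chamber of \<open>xs\<close> the hyperplanes \<open>z = w\<close> are stacked
  in the order of the chain, so the cuts can be made one after the other, and each use of
  \<open>dist2_cut\<close> contributes one wall. The induction peels off the smallest form
  \<open>a\<close>: either \<open>z\<close> is below it, or \<open>z\<close> is to be inserted in
  the tail.\<close>

lemma dist2_insertions:
  fixes f :: "real \<Rightarrow> real"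
  assumes "pointed_convex V"
  shows "(\<Sum>zs\<leftarrow>insertions z xs. f (dist2 n (V \<inter> chain_cone zs) x)) =
    f (dist2 n (V \<inter> chain_cone xs) x) +
    (\<Sum>w\<leftarrow>xs. f (dist2 n (V \<inter> chain_cone xs \<inter> {y. form_val y z = form_val y w}) x))"
  using assms
proof (induction xs arbitrary: V)
  case Nil
  then show ?case by (simp add: chain_cone_def)
next
  case (Cons a xs)
  let ?F = "\<lambda>C. f (dist2 n C x)"
  let ?C = "V \<inter> chain_cone (a # xs)"
  \<comment> \<open>All constraints on \<open>a\<close> are moved into the convex set, so that the
    induction hypothesis for the tail applies with \<open>W\<close> in place of
    \<open>V\<close>.\<close>
  define W where "W = (V \<inter> {y. \<forall>b\<in>set xs. form_val y a \<le> form_val y b}) \<inter> {y. form_val y a \<le> form_val y z}"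
  have "pointed_convex (\<Inter>b\<in>Z. {y. form_val y a \<le> form_val y b})" if "finite Z" for Z
    using that by induction (auto intro!: pointed_convex_Int)
  then have "pointed_convex (\<Inter>b\<in>set xs. {y. form_val y a \<le> form_val y b})" by simp
  moreover have "(\<Inter>b\<in>set xs. {y. form_val y a \<le> form_val y b}) = {y. \<forall>b\<in>set xs. form_val y a \<le> form_val y b}"
    by auto
  ultimately have W: "pointed_convex W"
    unfolding W_def using Cons.prems by (intro pointed_convex_Int) auto
  have C: "pointed_convex ?C" using Cons.prems by (auto intro: pointed_convex_Int)
  have 1: "?F (V \<inter> chain_cone (a # zs)) = ?F (W \<inter> chain_cone zs)" if "zs \<in> set (insertions z xs)" for zs
    using insertions_set[OF that] by (intro arg_cong[where f = ?F]) (auto simp: W_def chain_cone_def)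
  have 2: "W \<inter> chain_cone xs = ?C \<inter> {y. form_val y a \<le> form_val y z}"
    by (auto simp: W_def chain_cone_def)
  \<comment> \<open>\<open>a <= w\<close> and \<open>z = w\<close> imply \<open>a <= z\<close>: the
    constraint hidden in \<open>W\<close> does not truncate the later walls.\<close>
  have 3: "W \<inter> chain_cone xs \<inter> {y. form_val y z = form_val y w} = ?C \<inter> {y. form_val y z = form_val y w}"
    if "w \<in> set xs" for w using that by (auto simp: W_def chain_cone_def)
  have 4: "V \<inter> chain_cone (z # a # xs) = ?C \<inter> {y. form_val y z \<le> form_val y a}"
    by (fastforce simp: chain_cone_def)
  have "(\<Sum>zs\<leftarrow>insertions z (a # xs). ?F (V \<inter> chain_cone zs)) =
      ?F (?C \<inter> {y. form_val y z \<le> form_val y a}) + (\<Sum>zs\<leftarrow>insertions z xs. ?F (V \<inter> chain_cone (a # zs)))"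
    by (simp add: o_def 4)
  also have "(\<Sum>zs\<leftarrow>insertions z xs. ?F (V \<inter> chain_cone (a # zs))) =
      (\<Sum>zs\<leftarrow>insertions z xs. ?F (W \<inter> chain_cone zs))"
    by (intro arg_cong[where f = sum_list] map_cong refl 1)
  also have "\<dots> = ?F (?C \<inter> {y. form_val y a \<le> form_val y z}) +
      (\<Sum>w\<leftarrow>xs. ?F (W \<inter> chain_cone xs \<inter> {y. form_val y z = form_val y w}))"
    using Cons.IH[OF W] by (simp add: 2)
  also have "(\<Sum>w\<leftarrow>xs. ?F (W \<inter> chain_cone xs \<inter> {y. form_val y z = form_val y w})) =
      (\<Sum>w\<leftarrow>xs. ?F (?C \<inter> {y. form_val y z = form_val y w}))"
    by (intro arg_cong[where f = sum_list] map_cong refl) (simp add: 3)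
  finally show ?case
    using dist2_cut[OF C, of "\<lambda>y. form_val y z" "\<lambda>y. form_val y a" f n x] by simp
qed

section \<open>Chambers and flats\<close>

text \<open>The arrangement is built one coordinate at a time: \<open>H j\<close> lists the hyperplanes that involve
  coordinate \<open>j\<close> and earlier ones only. The flats are paired with their dimension (inside the first
  \<open>j\<close> coordinates) and repeated according to the absolute value of their Moebius function.\<close>

fun flats :: "(nat \<Rightarrow> (nat \<Rightarrow> real) set list) \<Rightarrow> nat \<Rightarrow> ((nat \<Rightarrow> real) set \<times> nat) list" where
  "flats H 0 = [(UNIV, 0)]"
| "flats H (Suc j) = concat (map (\<lambda>(L, k). (L, Suc k) # map (\<lambda>P. (L \<inter> P, k)) (H j)) (flats H j))"

definition hyperplanes_A :: "nat \<Rightarrow> (nat \<Rightarrow> real) set list" where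
  "hyperplanes_A j = map (\<lambda>i. {y. y j = y i}) [0..<j]"

definition hyperplanes_B :: "nat \<Rightarrow> (nat \<Rightarrow> real) set list" where
  "hyperplanes_B j = {y. y j = 0} # concat (map (\<lambda>i. [{y. y j = y i}, {y. y j = - y i}]) [0..<j])"

fun chains_A :: "nat \<Rightarrow> (real \<times> nat) list list" where
  "chains_A 0 = [[]]"
| "chains_A (Suc j) = concat (map (insertions (1, j)) (chains_A j))"

fun chains_B :: "nat \<Rightarrow> (real \<times> nat) list list" where
  "chains_B 0 = [[]]"
| "chains_B (Suc j) =
    concat (map (\<lambda>xs. insertions (1, j) xs @ insertions (-1, j) xs) (chains_B j))"

text \<open>A chamber of type B: the signs in the list make all forms nonnegative, and their order
  is that of the absolute values. Nonnegativity is asked of every entry, so that this part depends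
  on the set of entries only and is the same for all insertions.\<close>

definition positive_chain_cone :: "(real \<times> nat) list \<Rightarrow> (nat \<Rightarrow> real) set" where
  "positive_chain_cone zs = {y. \<forall>z\<in>set zs. 0 \<le> form_val y z} \<inter> chain_cone zs"

lemma sum_list_concat:
  fixes xss :: "'a::comm_monoid_add list list"
  shows "sum_list (concat xss) = (\<Sum>xs\<leftarrow>xss. sum_list xs)"
  by (induction xss) auto

lemma sum_list_concat_map:
  fixes f :: "'b \<Rightarrow> 'c::comm_monoid_add"
  shows "(\<Sum>y\<leftarrow>concat (map g xs). f y) = (\<Sum>x\<leftarrow>xs. \<Sum>y\<leftarrow>g x. f y)"
  by (induction xs) auto

lemma sum_list_swap:
  fixes f :: "'a \<Rightarrow> 'b \<Rightarrow> 'c::comm_monoid_add"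
  shows "(\<Sum>x\<leftarrow>xs. \<Sum>y\<leftarrow>ys. f x y) = (\<Sum>y\<leftarrow>ys. \<Sum>x\<leftarrow>xs. f x y)"
  by (induction xs) (auto simp: sum_list_addf)

lemma chains_A_mset:
  "xs \<in> set (chains_A j) \<Longrightarrow> mset xs = mset (map (Pair 1) [0..<j])"
  by (induction j arbitrary: xs) (auto dest!: insertions_mset)

lemma chains_B_indices:
  "xs \<in> set (chains_B j) \<Longrightarrow> mset (map snd xs) = mset [0..<j] \<and> fst ` set xs \<subseteq> {1, -1}"
proof (induction j arbitrary: xs)
  case (Suc j)
  then obtain ys s where ys: "ys \<in> set (chains_B j)" "xs \<in> set (insertions (s, j) ys)" "s = 1 \<or> s = -1"
    by auto
  with Suc.IH[OF ys(1)] show ?case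
    using insertions_mset[OF ys(2)] insertions_set[OF ys(2)] by auto
qed auto

lemma chains_A_indices:
  "xs \<in> set (chains_A j) \<Longrightarrow> mset (map snd xs) = mset [0..<j] \<and> fst ` set xs \<subseteq> {1, -1}"
  by (drule chains_A_mset) (auto simp flip: set_mset_mset simp: image_mset.compositionality o_def)

text \<open>Chains list the coordinates in different orders; a sum over entries that sees only their
  indices is therefore the same for every chain. This makes the walls independent of the chamber
  that produced them.\<close>

lemma sum_list_by_index:
  fixes \<phi> :: "nat \<Rightarrow> 'c::comm_monoid_add"
  assumes "mset (map snd xs) = mset [0..<j]"
  shows "(\<Sum>w\<leftarrow>xs. \<phi> (snd w)) = (\<Sum>i\<leftarrow>[0..<j]. \<phi> i)"
proof -
  have "sum_list (map \<phi> (map snd xs)) = sum_list (map \<phi> [0..<j])"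
    by (metis assms mset_map sum_mset_sum_list)
  then show ?thesis by (simp add: o_def)
qed

lemma length_chains_A: "length (chains_A j) = fact j"
proof (induction j)
  case (Suc j)
  have "length xs = j" if "xs \<in> set (chains_A j)" for xs
    using chains_A_mset[OF that] by (metis length_map length_upt diff_zero mset_eq_length)
  then have "length (chains_A (Suc j)) = (\<Sum>xs\<leftarrow>chains_A j. Suc j)"
    by (auto simp: length_concat o_def intro!: arg_cong[where f = sum_list])
  then show ?case by (simp add: Suc sum_list_triv)
qed auto

lemma length_chains_B: "length (chains_B j) = 2 ^ j * fact j"
proof (induction j)
  case (Suc j)
  have "length xs = j" if "xs \<in> set (chains_B j)" for xs
    using chains_B_indices[OF that] by (metis length_map length_upt diff_zero mset_eq_length)
  then have "length (chains_B (Suc j)) = (\<Sum>xs\<leftarrow>chains_B j. 2 * Suc j)"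
    by (auto simp: length_concat o_def intro!: arg_cong[where f = sum_list])
  then show ?case by (simp add: Suc sum_list_triv algebra_simps)
qed auto

text \<open>A wall term of \<open>dist2_insertions\<close> is again a chamber of the first
  \<open>j\<close> coordinates, taken inside \<open>V\<close> cut by \<open>y j = y i\<close>.
  Summed over all chambers it falls under the induction hypothesis for the smaller convex
  set.\<close>

lemma dist2_chambers_A:
  fixes f :: "real \<Rightarrow> real"
  assumes "pointed_convex V"
  shows "(\<Sum>zs\<leftarrow>chains_A j. f (dist2 n (V \<inter> chain_cone zs) x)) =
    (\<Sum>(L, k)\<leftarrow>flats hyperplanes_A j. f (dist2 n (V \<inter> L) x))"
  using assms
proof (induction j arbitrary: V)
  case 0
  then show ?case by (simp add: chain_cone_def)
next
  case (Suc j)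
  let ?F = "\<lambda>C. f (dist2 n C x)"
  have *: "(\<Sum>zs\<leftarrow>insertions (1, j) xs. ?F (V \<inter> chain_cone zs)) =
      ?F (V \<inter> chain_cone xs) + (\<Sum>i\<leftarrow>[0..<j]. ?F (V \<inter> {y. y j = y i} \<inter> chain_cone xs))"
    if xs: "xs \<in> set (chains_A j)" for xs
  proof -
    have "(\<Sum>w\<leftarrow>xs. ?F (V \<inter> chain_cone xs \<inter> {y. form_val y (1, j) = form_val y w})) =
        (\<Sum>w\<leftarrow>xs. ?F (V \<inter> {y. y j = y (snd w)} \<inter> chain_cone xs))"
    proof (intro arg_cong[where f = sum_list] map_cong refl)
      fix w assume "w \<in> set xs"
      moreover have "set xs = Pair 1 ` {0..<j}"
        using chains_A_mset[OF xs] by (metis set_mset_mset set_map set_upt)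
      ultimately have "fst w = 1" by auto
      then show "?F (V \<inter> chain_cone xs \<inter> {y. form_val y (1, j) = form_val y w}) =
          ?F (V \<inter> {y. y j = y (snd w)} \<inter> chain_cone xs)"
        by (intro arg_cong[where f = ?F]) (auto simp: form_val_def)
    qed
    also have "\<dots> = (\<Sum>i\<leftarrow>[0..<j]. ?F (V \<inter> {y. y j = y i} \<inter> chain_cone xs))"
      by (rule sum_list_by_index) (use chains_A_indices[OF xs] in simp)
    finally show ?thesis using dist2_insertions[OF Suc.prems] by metis
  qed
  have hyp: "pointed_convex (V \<inter> {y. y j = y i})" for i
    by (intro pointed_convex_Int pointed_convex_hyperplane Suc.prems) auto
  have "(\<Sum>zs\<leftarrow>chains_A (Suc j). ?F (V \<inter> chain_cone zs)) =
      (\<Sum>xs\<leftarrow>chains_A j. ?F (V \<inter> chain_cone xs) +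
        (\<Sum>i\<leftarrow>[0..<j]. ?F (V \<inter> {y. y j = y i} \<inter> chain_cone xs)))"
    by (simp add: sum_list_concat_map o_def, intro arg_cong[where f = sum_list] map_cong refl) (simp add: *)
  also have "\<dots> = (\<Sum>xs\<leftarrow>chains_A j. ?F (V \<inter> chain_cone xs)) +
      (\<Sum>i\<leftarrow>[0..<j]. \<Sum>xs\<leftarrow>chains_A j. ?F (V \<inter> {y. y j = y i} \<inter> chain_cone xs))"
    by (subst sum_list_addf, subst sum_list_swap) simp
  also have "\<dots> = (\<Sum>(L, k)\<leftarrow>flats hyperplanes_A j. ?F (V \<inter> L)) +
      (\<Sum>i\<leftarrow>[0..<j]. \<Sum>(L, k)\<leftarrow>flats hyperplanes_A j. ?F (V \<inter> {y. y j = y i} \<inter> L))"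
    by (simp add: Suc.IH[OF Suc.prems] Suc.IH[OF hyp])
  also have "\<dots> = (\<Sum>(L, k)\<leftarrow>flats hyperplanes_A j. ?F (V \<inter> L) +
      (\<Sum>i\<leftarrow>[0..<j]. ?F (V \<inter> (L \<inter> {y. y j = y i}))))"
    by (subst sum_list_swap) (simp add: case_prod_unfold sum_list_addf Int_ac)
  also have "\<dots> = (\<Sum>(L, k)\<leftarrow>flats hyperplanes_A (Suc j). ?F (V \<inter> L))"
    by (simp add: sum_list_concat_map o_def case_prod_unfold hyperplanes_A_def)
  finally show ?case .
qed

text \<open>As for type A, but the new coordinate enters with either sign. On each side of
  \<open>y j = 0\<close> the nonnegative form \<open>y j\<close> or \<open>- y j\<close> is inserted
  among nonnegative forms, and the two sides are glued by one more cut.\<close>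

lemma dist2_chambers_B:
  fixes f :: "real \<Rightarrow> real"
  assumes "pointed_convex V"
  shows "(\<Sum>zs\<leftarrow>chains_B j. f (dist2 n (V \<inter> positive_chain_cone zs) x)) =
    (\<Sum>(L, k)\<leftarrow>flats hyperplanes_B j. f (dist2 n (V \<inter> L) x))"
  using assms
proof (induction j arbitrary: V)
  case 0
  then show ?case by (simp add: positive_chain_cone_def chain_cone_def)
next
  case (Suc j)
  let ?F = "\<lambda>C. f (dist2 n C x)"
  have pos: "pointed_convex {y. 0 \<le> form_val y z}" for z
    by (rule pointed_convex_halfspace) auto
  have pos_Ball: "pointed_convex {y. \<forall>z\<in>set zs. 0 \<le> form_val y z}" for zs
  proof (induction zs)
    case (Cons z zs)
    have "{y. \<forall>z\<in>set (z # zs). 0 \<le> form_val y z} =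
      {y. 0 \<le> form_val y z} \<inter> {y. \<forall>z\<in>set zs. 0 \<le> form_val y z}" by auto
    then show ?case by (simp only:) (intro pointed_convex_Int pos Cons)
  qed simp
  have *: "(\<Sum>zs\<leftarrow>insertions (1, j) xs. ?F (V \<inter> positive_chain_cone zs)) +
      (\<Sum>zs\<leftarrow>insertions (-1, j) xs. ?F (V \<inter> positive_chain_cone zs)) =
      ?F (V \<inter> positive_chain_cone xs) + ?F (V \<inter> {y. y j = 0} \<inter> positive_chain_cone xs) +
      (\<Sum>i\<leftarrow>[0..<j]. ?F (V \<inter> {y. y j = y i} \<inter> positive_chain_cone xs) +
         ?F (V \<inter> {y. y j = - y i} \<inter> positive_chain_cone xs))"
    if xs: "xs \<in> set (chains_B j)" for xs
  proof -
    let ?C = "V \<inter> positive_chain_cone xs"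
    have C: "pointed_convex ?C"
      unfolding positive_chain_cone_def
      by (intro pointed_convex_Int Suc.prems pos_Ball pointed_convex_chain_cone)
    have side: "(\<Sum>zs\<leftarrow>insertions (s, j) xs. ?F (V \<inter> positive_chain_cone zs)) =
        ?F (?C \<inter> {y. 0 \<le> s * y j}) + (\<Sum>w\<leftarrow>xs. ?F (?C \<inter> {y. s * y j = form_val y w}))" for s
    proof -
      define W where "W = V \<inter> {y. \<forall>z\<in>set ((s, j) # xs). 0 \<le> form_val y z}"
      have W: "pointed_convex W" unfolding W_def by (intro pointed_convex_Int Suc.prems pos_Ball)
      have "(\<Sum>zs\<leftarrow>insertions (s, j) xs. ?F (V \<inter> positive_chain_cone zs)) =
          (\<Sum>zs\<leftarrow>insertions (s, j) xs. ?F (W \<inter> chain_cone zs))"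
        by (intro arg_cong[where f = sum_list] map_cong refl arg_cong[where f = ?F])
          (auto simp: W_def positive_chain_cone_def dest!: insertions_set)
      also have "\<dots> = ?F (W \<inter> chain_cone xs) +
          (\<Sum>w\<leftarrow>xs. ?F (W \<inter> chain_cone xs \<inter> {y. form_val y (s, j) = form_val y w}))"
        by (rule dist2_insertions[OF W])
      also have "W \<inter> chain_cone xs = ?C \<inter> {y. 0 \<le> s * y j}"
        by (auto simp: W_def positive_chain_cone_def form_val_def)
      \<comment> \<open>A wall lies in the half-space automatically: there \<open>s * y j\<close>
        equals an entry of the chain, which is nonnegative on \<open>?C\<close>.\<close>
      also have "(\<Sum>w\<leftarrow>xs. ?F (?C \<inter> {y. 0 \<le> s * y j} \<inter> {y. form_val y (s, j) = form_val y w})) =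
          (\<Sum>w\<leftarrow>xs. ?F (?C \<inter> {y. s * y j = form_val y w}))"
        by (intro arg_cong[where f = sum_list] map_cong refl arg_cong[where f = ?F])
          (auto simp: positive_chain_cone_def form_val_def)
      finally show ?thesis .
    qed
    have "?F ?C + ?F (V \<inter> {y. y j = 0} \<inter> positive_chain_cone xs) =
        ?F (?C \<inter> {y. 0 \<le> 1 * y j}) + ?F (?C \<inter> {y. 0 \<le> -1 * y j})"
      using dist2_cut[OF C linear_form_scaled_coord[of 1 j] linear_form_scaled_coord[of 0 0], of f n x]
      by (simp add: Int_ac)
    moreover have "(\<Sum>w\<leftarrow>xs. ?F (?C \<inter> {y. 1 * y j = form_val y w})) +
        (\<Sum>w\<leftarrow>xs. ?F (?C \<inter> {y. -1 * y j = form_val y w})) =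
        (\<Sum>w\<leftarrow>xs. ?F (V \<inter> {y. y j = y (snd w)} \<inter> positive_chain_cone xs) +
          ?F (V \<inter> {y. y j = - y (snd w)} \<inter> positive_chain_cone xs))"
      unfolding sum_list_addf[symmetric]
    proof (intro arg_cong[where f = sum_list] map_cong refl)
      \<comment> \<open>An entry with sign -1 interchanges the walls \<open>y j = y i\<close> and
        \<open>y j = - y i\<close>, so only the sum over both is free of the sign of the
        entry.\<close>
      fix w assume "w \<in> set xs"
      then have "fst w = 1 \<or> fst w = -1" using chains_B_indices[OF xs] by auto
      moreover have "{y :: nat \<Rightarrow> real. - y j = y i} = {y. y j = - y i}"
        "{y :: nat \<Rightarrow> real. - y j = - y i} = {y. y j = y i}" for i
        by - (rule Collect_cong, linarith)+
      ultimately show "?F (?C \<inter> {y. 1 * y j = form_val y w}) + ?F (?C \<inter> {y. -1 * y j = form_val y w}) =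
        ?F (V \<inter> {y. y j = y (snd w)} \<inter> positive_chain_cone xs) +
          ?F (V \<inter> {y. y j = - y (snd w)} \<inter> positive_chain_cone xs)"
        by (elim disjE) (simp_all add: form_val_def Int_ac)
    qed
    moreover have "\<dots> = (\<Sum>i\<leftarrow>[0..<j]. ?F (V \<inter> {y. y j = y i} \<inter> positive_chain_cone xs) +
          ?F (V \<inter> {y. y j = - y i} \<inter> positive_chain_cone xs))"
      by (rule sum_list_by_index) (use chains_B_indices[OF xs] in simp)
    ultimately show ?thesis using side[of 1] side[of "-1"] by simp
  qed
  have hyp: "pointed_convex (V \<inter> {y. y j = y i})" "pointed_convex (V \<inter> {y. y j = - y i})"
    "pointed_convex (V \<inter> {y. y j = 0})" for i
    by (intro pointed_convex_Int pointed_convex_hyperplane Suc.prems; simp)+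
  have "(\<Sum>zs\<leftarrow>chains_B (Suc j). ?F (V \<inter> positive_chain_cone zs)) =
      (\<Sum>xs\<leftarrow>chains_B j. ?F (V \<inter> positive_chain_cone xs) + ?F (V \<inter> {y. y j = 0} \<inter> positive_chain_cone xs) +
      (\<Sum>i\<leftarrow>[0..<j]. ?F (V \<inter> {y. y j = y i} \<inter> positive_chain_cone xs) +
         ?F (V \<inter> {y. y j = - y i} \<inter> positive_chain_cone xs)))"
    by (simp add: sum_list_concat_map o_def, intro arg_cong[where f = sum_list] map_cong refl) (simp add: *)
  also have "\<dots> = (\<Sum>xs\<leftarrow>chains_B j. ?F (V \<inter> positive_chain_cone xs)) +
      (\<Sum>xs\<leftarrow>chains_B j. ?F (V \<inter> {y. y j = 0} \<inter> positive_chain_cone xs)) +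
      (\<Sum>i\<leftarrow>[0..<j]. (\<Sum>xs\<leftarrow>chains_B j. ?F (V \<inter> {y. y j = y i} \<inter> positive_chain_cone xs)) +
        (\<Sum>xs\<leftarrow>chains_B j. ?F (V \<inter> {y. y j = - y i} \<inter> positive_chain_cone xs)))"
    by (subst sum_list_addf, subst sum_list_swap) (simp add: sum_list_addf)
  also have "\<dots> = (\<Sum>(L, k)\<leftarrow>flats hyperplanes_B j. ?F (V \<inter> L)) +
      (\<Sum>(L, k)\<leftarrow>flats hyperplanes_B j. ?F (V \<inter> {y. y j = 0} \<inter> L)) +
      (\<Sum>i\<leftarrow>[0..<j]. (\<Sum>(L, k)\<leftarrow>flats hyperplanes_B j. ?F (V \<inter> {y. y j = y i} \<inter> L)) +
        (\<Sum>(L, k)\<leftarrow>flats hyperplanes_B j. ?F (V \<inter> {y. y j = - y i} \<inter> L)))"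
    by (simp add: Suc.IH[OF Suc.prems] Suc.IH[OF hyp(1)] Suc.IH[OF hyp(2)] Suc.IH[OF hyp(3)])
  also have "\<dots> = (\<Sum>(L, k)\<leftarrow>flats hyperplanes_B j. ?F (V \<inter> L) + ?F (V \<inter> (L \<inter> {y. y j = 0})) +
      (\<Sum>i\<leftarrow>[0..<j]. ?F (V \<inter> (L \<inter> {y. y j = y i})) + ?F (V \<inter> (L \<inter> {y. y j = - y i}))))"
    unfolding sum_list_addf[symmetric]
    by (subst sum_list_swap) (simp add: case_prod_unfold sum_list_addf Int_ac)
  also have "\<dots> = (\<Sum>(L, k)\<leftarrow>flats hyperplanes_B (Suc j). ?F (V \<inter> L))"
    by (simp add: sum_list_concat_map o_def case_prod_unfold hyperplanes_B_def map_concat add.assoc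
        sum_list_concat)
  finally show ?case .
qed

section \<open>Counting flats by dimension\<close>

lemma sum_list_flats:
  fixes w :: "nat \<Rightarrow> real"
  shows "(\<Sum>(L, k)\<leftarrow>flats H j. w k) =
    (\<Sum>k\<le>j. real (coeff (\<Prod>i<j. [:length (H i), 1:]) k) * w k)"
proof (induction j arbitrary: w)
  case (Suc j)
  let ?p = "\<Prod>i<j. [:length (H i), 1:]"
  let ?h = "length (H j)"
  have deg: "coeff ?p (Suc j) = 0"
  proof (rule coeff_eq_0)
    have "degree ?p \<le> (\<Sum>i<j. degree [:length (H i), 1:])"
      by (rule order_trans[OF degree_prod_sum_le]) auto
    then show "degree ?p < Suc j" by simp
  qed
  have "(\<Sum>(L, k)\<leftarrow>flats H (Suc j). w k) = (\<Sum>(L, k)\<leftarrow>flats H j. w (Suc k) + real ?h * w k)"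
    by (simp add: sum_list_concat_map o_def case_prod_unfold sum_list_triv)
  also have "\<dots> = (\<Sum>k\<le>j. real (coeff ?p k) * (w (Suc k) + real ?h * w k))"
    by (rule Suc.IH)
  also have "\<dots> = (\<Sum>k\<le>j. real (coeff ?p k) * w (Suc k)) + (\<Sum>k\<le>j. real ?h * real (coeff ?p k) * w k)"
    by (simp add: algebra_simps sum.distrib)
  also have "(\<Sum>k\<le>j. real (coeff ?p k) * w (Suc k)) = (\<Sum>k\<le>Suc j. real (coeff (pCons 0 ?p) k) * w k)"
    by (subst sum.atMost_Suc_shift) simp
  also have "(\<Sum>k\<le>j. real ?h * real (coeff ?p k) * w k) = (\<Sum>k\<le>Suc j. real ?h * real (coeff ?p k) * w k)"
    using deg by simp
  finally show ?case
    by (simp add: sum.distrib[symmetric] algebra_simps del: sum.atMost_Suc One_nat_def)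
qed simp

text \<open>Step \<open>n\<close> contributes the factor \<open>t + n\<close>, and multiplication by
  it is the recurrence of the unsigned Stirling numbers of the first kind.\<close>

lemma coeff_hyperplanes_A: "coeff (\<Prod>i<n. [:length (hyperplanes_A i), 1:]) k = stirling n k"
proof (induction n arbitrary: k)
  case 0
  then show ?case by (cases k) auto
next
  case (Suc n)
  have "coeff (\<Prod>i<Suc n. [:length (hyperplanes_A i), 1:]) k =
    n * stirling n k + (case k of 0 \<Rightarrow> 0 | Suc k \<Rightarrow> stirling n k)"
    using Suc.IH by (simp add: hyperplanes_A_def coeff_pCons mult.commute[of "prod _ _"] split: nat.split)
  then show ?case by (cases k; cases n) auto
qed

lemma length_hyperplanes_B: "length (hyperplanes_B j) = 2 * j + 1"
  by (simp add: hyperplanes_B_def length_concat o_def sum_list_triv)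

lemma coeff_hyperplanes_B: "coeff (\<Prod>i<n. [:length (hyperplanes_B i), 1:]) k = B_num n k"
  by (simp add: B_num_def length_hyperplanes_B)

text \<open>The two polynomials share all but the last factor, and
  \<open>(t + 2 * n - 1) - (t + n - 1) = n\<close>. The common part is the type B polynomial in
  dimension \<open>n - 1\<close>. Passing to integers avoids truncated subtraction.\<close>

lemma D_num_B_num:
  assumes "2 \<le> n"
  shows "int (D_num n k) = int (B_num n k) - int n * int (B_num (n - 1) k)"
proof -
  obtain m where n: "n = Suc m" using assms by (cases n) auto
  let ?p = "\<Prod>i<m. [:2 * i + 1, 1:] :: nat poly"
  have "coeff (?p * [:2 * m + 1, 1:]) k = coeff (?p * [:m, 1:]) k + Suc m * coeff ?p k"
    by (simp add: mult.commute[of ?p] algebra_simps)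
  then show ?thesis by (simp add: n D_num_def B_num_def algebra_simps)
qed

section \<open>Gaussian, gamma and beta integrals\<close>

definition gauss1 :: "real measure" where
  "gauss1 = density lborel (\<lambda>x. ennreal (std_normal_density x))"

lemma gauss_eq: "gauss n = PiM {..<n} (\<lambda>_. gauss1)"
  by (simp add: gauss_def gauss1_def)

lemma sets_gauss1 [measurable_cong, simp]: "sets gauss1 = sets borel"
  by (simp add: gauss1_def)

lemma space_gauss1 [simp]: "space gauss1 = UNIV"
  by (simp add: gauss1_def)

lemma prob_space_gauss1: "prob_space gauss1"
  unfolding gauss1_def by (rule prob_space_normal_density) simp

interpretation gauss1: prob_space gauss1
  by (rule prob_space_gauss1)

interpretation gauss_prod: product_sigma_finite "\<lambda>_::nat. gauss1"
  by standard

lemma prob_space_PiM_gauss1: "prob_space (PiM J (\<lambda>_. gauss1))"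
  by (rule prob_space_PiM) (rule prob_space_gauss1)

lemma prob_space_gauss: "prob_space (gauss n)"
  by (simp add: gauss_eq prob_space_PiM_gauss1)

lemma nn_integral_gauss1:
  assumes "f \<in> borel_measurable borel"
  shows "(\<integral>\<^sup>+x. f x \<partial>gauss1) = (\<integral>\<^sup>+x. ennreal (std_normal_density x) * f x \<partial>lborel)"
  unfolding gauss1_def using assms by (subst nn_integral_density) auto

text \<open>Up to its constant, the density of the chi-square law with \<open>2 * p\<close> degrees
  of freedom. The normalising constant is left out here and recovered at the end from total mass
  1.\<close>

definition gamma_kernel :: "real \<Rightarrow> real \<Rightarrow> ennreal" where
  "gamma_kernel p t = ennreal (t powr (p - 1) * exp (- t / 2)) * indicator {0<..} t"

definition beta_kernel :: "real \<Rightarrow> real \<Rightarrow> real \<Rightarrow> ennreal" where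
  "beta_kernel p q t = ennreal (t powr (p - 1) * (1 - t) powr (q - 1)) * indicator {0<..<1} t"

lemma measurable_kernels [measurable]:
  "gamma_kernel p \<in> borel_measurable borel" "beta_kernel p q \<in> borel_measurable borel"
  unfolding gamma_kernel_def[abs_def] beta_kernel_def[abs_def] by measurable

lemma nn_integral_square_substitution:
  fixes f :: "real \<Rightarrow> ennreal"
  assumes [measurable]: "f \<in> borel_measurable borel"
  shows "(\<integral>\<^sup>+t. f t * indicator {0..} t \<partial>lborel) =
    (\<integral>\<^sup>+x. f (x\<^sup>2) * ennreal (2 * x) * indicator {0..} x \<partial>lborel)"
proof -
  have SUP_ind: "(SUP m. indicator {0..c m} x) = (indicator {0..} x :: ennreal)"
    if c: "incseq c" "\<And>y. \<exists>m. y \<le> c m" for c :: "nat \<Rightarrow> real" and x :: real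
  proof (rule antisym)
    show "(SUP m. indicator {0..c m} x) \<le> (indicator {0..} x :: ennreal)"
      by (intro SUP_least) (auto split: split_indicator)
    obtain m where "x \<le> c m" using c(2)[of x] by auto
    then have "(indicator {0..} x :: ennreal) \<le> indicator {0..c m} x" by (auto split: split_indicator)
    also have "\<dots> \<le> (SUP m. indicator {0..c m} x)" by (rule SUP_upper) auto
    finally show "(indicator {0..} x :: ennreal) \<le> (SUP m. indicator {0..c m} x)" .
  qed
  have conv: "(\<integral>\<^sup>+t. g t * indicator {0..} t \<partial>lborel) =
      (SUP m. (\<integral>\<^sup>+t. g t * indicator {0..c m} t \<partial>lborel))"
    if [measurable]: "g \<in> borel_measurable borel" and c: "incseq c" "\<And>y. \<exists>m. y \<le> c m"
    for c :: "nat \<Rightarrow> real" and g :: "real \<Rightarrow> ennreal"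
  proof -
    have "incseq (\<lambda>m t. g t * indicator {0..c m} t)"
      using c(1) by (auto simp: incseq_def le_fun_def intro!: mult_left_mono split: split_indicator)
        (meson order_trans)
    then show ?thesis
      by (subst nn_integral_monotone_convergence_SUP[symmetric])
        (auto simp: SUP_mult_left_ennreal[symmetric] SUP_ind[OF c])
  qed
  have c1: "incseq (\<lambda>m. real m)" "\<exists>m. y \<le> real m" for y
    by (auto simp: incseq_def real_arch_simple)
  have c2: "incseq (\<lambda>m. (real m)\<^sup>2)" "\<exists>m. y \<le> (real m)\<^sup>2" for y
  proof -
    show "incseq (\<lambda>m. (real m)\<^sup>2)" by (auto simp: incseq_def intro!: power_mono)
    obtain m where "y \<le> real m" using real_arch_simple by auto
    also have "real m \<le> (real m)\<^sup>2" by (cases m) (auto simp: power2_eq_square)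
    finally show "\<exists>m. y \<le> (real m)\<^sup>2" by auto
  qed
  have "(\<integral>\<^sup>+t. f t * indicator {0..(real m)\<^sup>2} t \<partial>lborel) =
      (\<integral>\<^sup>+x. f (x\<^sup>2) * ennreal (2 * x) * indicator {0..real m} x \<partial>lborel)" for m
  proof (cases "m = 0")
    case True
    have "(\<integral>\<^sup>+t. g t * indicator {0..0} t \<partial>lborel) = 0" for g :: "real \<Rightarrow> ennreal"
      using nn_integral_null_set[of "{0}" lborel g] by (simp add: finite_imp_null_set_lborel)
    then show ?thesis using True by simp
  next
    case False
    have "((\<lambda>x. x\<^sup>2) has_real_derivative 2 * x) (at x)" for x :: real
      by (auto intro!: derivative_eq_intros)
    then show ?thesis
      using nn_integral_substitution_aux[of f 0 "real m" "\<lambda>x. x\<^sup>2" "\<lambda>x. 2 * x"] False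
      by (auto intro!: continuous_intros)
  qed
  then show ?thesis
    by (subst conv[OF _ c2], simp, subst conv[OF _ c1], simp) simp
qed

lemma nn_integral_lborel_even:
  fixes f :: "real \<Rightarrow> ennreal"
  assumes [measurable]: "f \<in> borel_measurable borel" and even: "\<And>x. f (- x) = f x"
  shows "(\<integral>\<^sup>+x. f x \<partial>lborel) = 2 * (\<integral>\<^sup>+x. f x * indicator {0..} x \<partial>lborel)"
proof -
  have "(\<integral>\<^sup>+x. f x \<partial>lborel) = (\<integral>\<^sup>+x. f x * indicator {0..} x + f x * indicator {..0} x \<partial>lborel)"
    by (intro nn_integral_cong_AE eventually_mono[OF AE_lborel_singleton[of 0]])
      (auto split: split_indicator)
  also have "\<dots> = (\<integral>\<^sup>+x. f x * indicator {0..} x \<partial>lborel) + (\<integral>\<^sup>+x. f x * indicator {..0} x \<partial>lborel)"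
    by (rule nn_integral_add) auto
  also have "(\<integral>\<^sup>+x. f x * indicator {..0} x \<partial>lborel) = (\<integral>\<^sup>+x. f x * indicator {0..} x \<partial>lborel)"
    by (subst nn_integral_real_affine[where c = "-1" and t = 0])
      (auto simp: even intro!: nn_integral_cong split: split_indicator)
  finally show ?thesis by (simp add: mult_2)
qed

text \<open>The two square roots of \<open>t\<close> give a factor 2 that cancels the one in
  \<open>dt = 2 * x * dx\<close>; what remains is the exponent \<open>- 1/2\<close> of the kernel
  with parameter 1/2.\<close>

lemma nn_integral_gauss1_square:
  fixes h :: "real \<Rightarrow> ennreal"
  assumes [measurable]: "h \<in> borel_measurable borel"
  shows "(\<integral>\<^sup>+x. h (x\<^sup>2) \<partial>gauss1) =
    ennreal (1 / sqrt (2 * pi)) * (\<integral>\<^sup>+t. h t * gamma_kernel (1/2) t \<partial>lborel)"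
proof -
  let ?c = "ennreal (1 / sqrt (2 * pi))"
  have density: "ennreal (std_normal_density x) = ?c * ennreal (exp (- x\<^sup>2 / 2))" for x
    by (simp add: std_normal_density_def ennreal_mult'[symmetric])
  have "(\<integral>\<^sup>+x. h (x\<^sup>2) \<partial>gauss1) = (\<integral>\<^sup>+x. ?c * (h (x\<^sup>2) * ennreal (exp (- x\<^sup>2 / 2))) \<partial>lborel)"
    by (subst nn_integral_gauss1) (auto simp: density mult_ac intro!: nn_integral_cong)
  also have "\<dots> = ?c * (2 * (\<integral>\<^sup>+x. h (x\<^sup>2) * ennreal (exp (- x\<^sup>2 / 2)) * indicator {0..} x \<partial>lborel))"
    by (subst nn_integral_cmult, simp, subst nn_integral_lborel_even) auto
  also have "2 * (\<integral>\<^sup>+x. h (x\<^sup>2) * ennreal (exp (- x\<^sup>2 / 2)) * indicator {0..} x \<partial>lborel) =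
      (\<integral>\<^sup>+x. 2 * (h (x\<^sup>2) * ennreal (exp (- x\<^sup>2 / 2)) * indicator {0..} x) \<partial>lborel)"
    by (subst nn_integral_cmult) auto
  also have "\<dots> = (\<integral>\<^sup>+x. (h (x\<^sup>2) * gamma_kernel (1/2) (x\<^sup>2)) * ennreal (2 * x) * indicator {0..} x \<partial>lborel)"
  proof (intro nn_integral_cong_AE eventually_mono[OF AE_lborel_singleton[of 0]])
    fix x :: real assume x: "x \<noteq> 0"
    have "gamma_kernel (1/2) (x\<^sup>2) * ennreal (2 * x) = 2 * ennreal (exp (- x\<^sup>2 / 2))" if "0 < x"
    proof -
      have "(x\<^sup>2) powr (1/2 - 1) = inverse x"
        using that by (simp add: powr_minus powr_half_sqrt)
      then have "(x\<^sup>2) powr (1/2 - 1) * exp (- x\<^sup>2 / 2) * (2 * x) = 2 * exp (- x\<^sup>2 / 2)"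
        using that by simp
      then show ?thesis
        using that by (simp add: gamma_kernel_def ennreal_mult'[symmetric] flip: ennreal_numeral)
    qed
    then have "h (x\<^sup>2) * (gamma_kernel (1/2) (x\<^sup>2) * ennreal (2 * x)) =
        2 * (h (x\<^sup>2) * ennreal (exp (- x\<^sup>2 / 2)))" if "0 < x"
      using that by (simp only:) (simp add: mult_ac)
    then show "2 * (h (x\<^sup>2) * ennreal (exp (- x\<^sup>2 / 2)) * indicator {0..} x) =
        (h (x\<^sup>2) * gamma_kernel (1/2) (x\<^sup>2)) * ennreal (2 * x) * indicator {0..} x"
      using x by (simp add: mult.assoc split: split_indicator)
  qed
  also have "\<dots> = (\<integral>\<^sup>+t. h t * gamma_kernel (1/2) t * indicator {0..} t \<partial>lborel)"
    by (rule nn_integral_square_substitution[symmetric]) simp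
  also have "\<dots> = (\<integral>\<^sup>+t. h t * gamma_kernel (1/2) t \<partial>lborel)"
    by (intro nn_integral_cong) (auto simp: gamma_kernel_def split: split_indicator)
  finally show ?thesis .
qed

text \<open>In the variables \<open>s = x + y\<close> and \<open>t = x / s\<close> the kernels
  separate, which is the independence of sum and ratio of gamma variables. A shift of
  \<open>y\<close>, an exchange of integrals and a dilation \<open>x = s * t\<close> replace the
  planar Jacobian.\<close>

lemma nn_integral_gamma_beta:
  fixes h :: "real \<Rightarrow> real \<Rightarrow> ennreal"
  assumes [measurable]: "case_prod h \<in> borel_measurable (borel \<Otimes>\<^sub>M borel)"
  shows "(\<integral>\<^sup>+x. \<integral>\<^sup>+y. h (x + y) (x / (x + y)) * (gamma_kernel p x * gamma_kernel q y) \<partial>lborel \<partial>lborel) =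
    (\<integral>\<^sup>+s. \<integral>\<^sup>+t. h s t * (gamma_kernel (p + q) s * beta_kernel p q t) \<partial>lborel \<partial>lborel)"
proof -
  have "(\<integral>\<^sup>+x. \<integral>\<^sup>+y. h (x + y) (x / (x + y)) * (gamma_kernel p x * gamma_kernel q y) \<partial>lborel \<partial>lborel) =
      (\<integral>\<^sup>+x. \<integral>\<^sup>+s. h s (x / s) * (gamma_kernel p x * gamma_kernel q (s - x)) \<partial>lborel \<partial>lborel)"
  proof (rule nn_integral_cong)
    fix x :: real
    show "(\<integral>\<^sup>+y. h (x + y) (x / (x + y)) * (gamma_kernel p x * gamma_kernel q y) \<partial>lborel) =
      (\<integral>\<^sup>+s. h s (x / s) * (gamma_kernel p x * gamma_kernel q (s - x)) \<partial>lborel)"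
      using nn_integral_real_affine[of
          "\<lambda>y. h (x + y) (x / (x + y)) * (gamma_kernel p x * gamma_kernel q y)" 1 "- x"]
      by simp
  qed
  also have "\<dots> = (\<integral>\<^sup>+s. \<integral>\<^sup>+x. h s (x / s) * (gamma_kernel p x * gamma_kernel q (s - x)) \<partial>lborel \<partial>lborel)"
    by (rule lborel_pair.Fubini') simp
  also have "\<dots> = (\<integral>\<^sup>+s. \<integral>\<^sup>+t. h s t * (gamma_kernel (p + q) s * beta_kernel p q t) \<partial>lborel \<partial>lborel)"
  proof (rule nn_integral_cong)
    fix s :: real
    show "(\<integral>\<^sup>+x. h s (x / s) * (gamma_kernel p x * gamma_kernel q (s - x)) \<partial>lborel) =
      (\<integral>\<^sup>+t. h s t * (gamma_kernel (p + q) s * beta_kernel p q t) \<partial>lborel)"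
    proof (cases "0 < s")
      case False
      then have z: "h s (x / s) * (gamma_kernel p x * gamma_kernel q (s - x)) = 0"
        "h s t * (gamma_kernel (p + q) s * beta_kernel p q t) = 0" for x t
        by (auto simp: gamma_kernel_def split: split_indicator)
      show ?thesis by (simp only: z)
    next
      case True
      \<comment> \<open>The factor \<open>s\<close> from the dilation is the power missing in
        \<open>s powr (p - 1) * s powr (q - 1)\<close> to reach the exponent
        \<open>p + q - 1\<close>.\<close>
      have ker: "ennreal s * (gamma_kernel p (s * t) * gamma_kernel q (s - s * t)) =
          gamma_kernel (p + q) s * beta_kernel p q t" for t
      proof (cases "0 < t \<and> t < 1")
        case t: True
        then have "0 < s - s * t" using True by simp
        moreover have "s - s * t = s * (1 - t)" by (simp add: algebra_simps)
        moreover have "s powr (p + q - 1) = s * s powr (p - 1) * s powr (q - 1)"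
          using True by (simp add: powr_add[symmetric] powr_mult_base add_diff_eq)
        moreover have "exp (- s / 2) = exp (- (s * t) / 2) * exp (- (s * (1 - t)) / 2)"
          by (simp add: exp_add[symmetric] field_simps)
        ultimately have "s * ((s * t) powr (p - 1) * exp (- (s * t) / 2) *
              ((s - s * t) powr (q - 1) * exp (- (s - s * t) / 2))) =
            s powr (p + q - 1) * exp (- s / 2) * (t powr (p - 1) * (1 - t) powr (q - 1))"
          using t True by (simp add: powr_mult mult_ac)
        then show ?thesis using t True \<open>0 < s - s * t\<close>
          by (simp add: gamma_kernel_def beta_kernel_def ennreal_mult'[symmetric])
      next
        case False
        then have "\<not> (0 < s * t \<and> 0 < s - s * t)"
          using True by (auto simp: zero_less_mult_iff)
        then show ?thesis using False
          by (auto simp: gamma_kernel_def beta_kernel_def split: split_indicator)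
      qed
      have "(\<integral>\<^sup>+x. h s (x / s) * (gamma_kernel p x * gamma_kernel q (s - x)) \<partial>lborel) =
        ennreal s * (\<integral>\<^sup>+t. h s t * (gamma_kernel p (s * t) * gamma_kernel q (s - s * t)) \<partial>lborel)"
        using True by (subst nn_integral_real_affine[where c = s and t = 0]) auto
      also have "\<dots> = (\<integral>\<^sup>+t. h s t * (ennreal s * (gamma_kernel p (s * t) * gamma_kernel q (s - s * t))) \<partial>lborel)"
        by (subst nn_integral_cmult[symmetric]) (auto simp: mult_ac)
      finally show ?thesis by (simp add: ker)
    qed
  qed
  finally show ?thesis .
qed

text \<open>Adding a coordinate adds 1/2 to the parameter: in \<open>nn_integral_gamma_beta\<close>
  the function \<open>h\<close> does not see \<open>t\<close>, so the beta integral comes out as a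
  factor. It joins the constant \<open>c\<close>, whose value is left open but is the same for all
  \<open>h\<close>.\<close>

lemma chi_square_law:
  fixes J :: "nat set"
  assumes "finite J" "J \<noteq> {}"
  shows "\<exists>c::ennreal. \<forall>h\<in>borel_measurable borel.
    (\<integral>\<^sup>+x. h (\<Sum>i\<in>J. (x i)\<^sup>2) \<partial>PiM J (\<lambda>_. gauss1)) =
    c * (\<integral>\<^sup>+t. h t * gamma_kernel (card J / 2) t \<partial>lborel)"
  using assms
proof (induction J rule: finite_ne_induct)
  case (singleton j)
  show ?case
  proof (intro exI ballI)
    fix h :: "real \<Rightarrow> ennreal" assume [measurable]: "h \<in> borel_measurable borel"
    have "(\<integral>\<^sup>+x. h (\<Sum>i\<in>{j}. (x i)\<^sup>2) \<partial>PiM {j} (\<lambda>_. gauss1)) = (\<integral>\<^sup>+x. h (x\<^sup>2) \<partial>gauss1)"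
      using gauss_prod.product_nn_integral_singleton[of "\<lambda>x. h (x\<^sup>2)" j] by simp
    then show "(\<integral>\<^sup>+x. h (\<Sum>i\<in>{j}. (x i)\<^sup>2) \<partial>PiM {j} (\<lambda>_. gauss1)) =
      ennreal (1 / sqrt (2 * pi)) * (\<integral>\<^sup>+t. h t * gamma_kernel (card {j} / 2) t \<partial>lborel)"
      by (simp add: nn_integral_gauss1_square)
  qed
next
  case (insert j J)
  then obtain c where c: "\<And>h. h \<in> borel_measurable borel \<Longrightarrow>
      (\<integral>\<^sup>+x. h (\<Sum>i\<in>J. (x i)\<^sup>2) \<partial>PiM J (\<lambda>_. gauss1)) =
      c * (\<integral>\<^sup>+t. h t * gamma_kernel (card J / 2) t \<partial>lborel)" by blast
  let ?d = "ennreal (1 / sqrt (2 * pi))"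
  let ?B = "\<integral>\<^sup>+t. beta_kernel (card J / 2) (1/2) t \<partial>lborel"
  show ?case
  proof (intro exI ballI)
    fix h :: "real \<Rightarrow> ennreal" assume [measurable]: "h \<in> borel_measurable borel"
    have "(\<integral>\<^sup>+x. h (\<Sum>i\<in>insert j J. (x i)\<^sup>2) \<partial>PiM (insert j J) (\<lambda>_. gauss1)) =
      (\<integral>\<^sup>+x. \<integral>\<^sup>+y. h (\<Sum>i\<in>insert j J. ((x(j := y)) i)\<^sup>2) \<partial>gauss1 \<partial>PiM J (\<lambda>_. gauss1))"
      using insert by (subst gauss_prod.product_nn_integral_insert) auto
    also have "\<dots> = (\<integral>\<^sup>+x. \<integral>\<^sup>+y. h ((\<Sum>i\<in>J. (x i)\<^sup>2) + y\<^sup>2) \<partial>gauss1 \<partial>PiM J (\<lambda>_. gauss1))"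
    proof (intro nn_integral_cong)
      fix x :: "nat \<Rightarrow> real" and y :: real
      have "(\<Sum>i\<in>J. ((x(j := y)) i)\<^sup>2) = (\<Sum>i\<in>J. (x i)\<^sup>2)"
        using insert.hyps by (intro sum.cong) auto
      then show "h (\<Sum>i\<in>insert j J. ((x(j := y)) i)\<^sup>2) = h ((\<Sum>i\<in>J. (x i)\<^sup>2) + y\<^sup>2)"
        using insert.hyps by (simp add: add.commute)
    qed
    also have "\<dots> = c * (\<integral>\<^sup>+x. (\<integral>\<^sup>+y. h (x + y\<^sup>2) \<partial>gauss1) * gamma_kernel (card J / 2) x \<partial>lborel)"
      by (rule c) measurable
    also have "\<dots> = c * (\<integral>\<^sup>+x. ?d * (\<integral>\<^sup>+y. h (x + y) * (gamma_kernel (card J / 2) x * gamma_kernel (1/2) y) \<partial>lborel) \<partial>lborel)"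
    proof (intro arg_cong[where f = "(*) c"] nn_integral_cong)
      fix x :: real
      have "(\<integral>\<^sup>+y. h (x + y\<^sup>2) \<partial>gauss1) = ?d * (\<integral>\<^sup>+y. h (x + y) * gamma_kernel (1/2) y \<partial>lborel)"
        by (rule nn_integral_gauss1_square) simp
      moreover have "(\<integral>\<^sup>+y. h (x + y) * gamma_kernel (1/2) y \<partial>lborel) * gamma_kernel (card J / 2) x =
        (\<integral>\<^sup>+y. h (x + y) * (gamma_kernel (card J / 2) x * gamma_kernel (1/2) y) \<partial>lborel)"
        by (subst nn_integral_multc[symmetric]) (auto simp: mult_ac)
      ultimately show "(\<integral>\<^sup>+y. h (x + y\<^sup>2) \<partial>gauss1) * gamma_kernel (card J / 2) x =
        ?d * (\<integral>\<^sup>+y. h (x + y) * (gamma_kernel (card J / 2) x * gamma_kernel (1/2) y) \<partial>lborel)"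
        by (simp add: mult.assoc)
    qed
    also have "\<dots> = c * (?d * (\<integral>\<^sup>+x. \<integral>\<^sup>+y. h (x + y) * (gamma_kernel (card J / 2) x * gamma_kernel (1/2) y) \<partial>lborel \<partial>lborel))"
      by (subst nn_integral_cmult) auto
    also have "\<dots> = c * (?d * (\<integral>\<^sup>+s. \<integral>\<^sup>+t. h s * (gamma_kernel (card J / 2 + 1/2) s * beta_kernel (card J / 2) (1/2) t) \<partial>lborel \<partial>lborel))"
      by (subst nn_integral_gamma_beta[of "\<lambda>s t. h s"]) auto
    also have "\<dots> = c * (?d * (\<integral>\<^sup>+s. h s * gamma_kernel (card (insert j J) / 2) s * ?B \<partial>lborel))"
      using insert.hyps by (simp add: mult.assoc[symmetric] nn_integral_cmult add_divide_distrib add.commute)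
    also have "\<dots> = (c * ?d * ?B) * (\<integral>\<^sup>+s. h s * gamma_kernel (card (insert j J) / 2) s \<partial>lborel)"
      by (subst nn_integral_multc) (auto simp: mult_ac)
    finally show "(\<integral>\<^sup>+x. h (\<Sum>i\<in>insert j J. (x i)\<^sup>2) \<partial>PiM (insert j J) (\<lambda>_. gauss1)) =
      (c * ?d * ?B) * (\<integral>\<^sup>+s. h s * gamma_kernel (card (insert j J) / 2) s \<partial>lborel)" .
  qed
qed

section \<open>Isometries preserving the Gaussian measure\<close>

text \<open>Linearity is not part of the notion, so norms are listed beside distances. Surjectivity
  refers to the whole function space, because cones are subsets of it; it makes a cone the image of
  its preimage.\<close>

definition gauss_isometry :: "nat \<Rightarrow> ((nat \<Rightarrow> real) \<Rightarrow> nat \<Rightarrow> real) \<Rightarrow> bool" where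
  "gauss_isometry n T \<longleftrightarrow> T \<in> measurable (gauss n) (gauss n) \<and> distr (gauss n) (gauss n) T = gauss n \<and>
    (\<forall>x y. (\<Sum>i<n. (T x i - T y i)\<^sup>2) = (\<Sum>i<n. (x i - y i)\<^sup>2)) \<and>
    (\<forall>x. (\<Sum>i<n. (T x i)\<^sup>2) = (\<Sum>i<n. (x i)\<^sup>2)) \<and> surj T"

lemma gauss_isometry_id: "gauss_isometry n id"
  by (simp add: gauss_isometry_def id_def distr_id2)

lemma gauss_isometry_comp:
  assumes "gauss_isometry n S" "gauss_isometry n T"
  shows "gauss_isometry n (S \<circ> T)"
proof -
  have "surj (S \<circ> T)" using assms by (intro comp_surj) (auto simp: gauss_isometry_def)
  moreover have "distr (gauss n) (gauss n) (S \<circ> T) = gauss n"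
    using assms distr_distr[of S "gauss n" "gauss n" T "gauss n"] by (simp add: gauss_isometry_def)
  ultimately show ?thesis
    using assms unfolding gauss_isometry_def by (auto intro: measurable_comp)
qed

lemma dist2_vimage_isometry:
  assumes "gauss_isometry n T"
  shows "dist2 n {y. T y \<in> C} x = dist2 n C (T x)"
proof -
  have "surj T" using assms by (simp add: gauss_isometry_def)
  define S where "S = {y. T y \<in> C}"
  have C: "C = T ` S" using \<open>surj T\<close> by (auto simp: S_def surj_def image_iff)
  have "dist2 n S x = dist2 n C (T x)"
    unfolding C dist2_def image_image using assms by (simp add: gauss_isometry_def)
  then show ?thesis by (simp add: S_def)
qed

text \<open>The event of \<open>dist_cdf\<close> with \<open>|g|^2\<close> cleared from the
  denominator; for cones both agree by homogeneity.\<close>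

definition dist2_prob :: "nat \<Rightarrow> (nat \<Rightarrow> real) set \<Rightarrow> real \<Rightarrow> real" where
  "dist2_prob n C lam = measure (gauss n)
     {g \<in> space (gauss n). (\<Sum>i<n. (g i)\<^sup>2) \<noteq> 0 \<and> dist2 n C g \<le> lam * (\<Sum>i<n. (g i)\<^sup>2)}"

lemma space_gauss: "space (gauss n) = PiE {..<n} (\<lambda>_. UNIV)"
  by (simp add: gauss_eq space_PiM)

lemma measurable_gauss_component [measurable]:
  "i < n \<Longrightarrow> (\<lambda>g. g i) \<in> borel_measurable (gauss n)"
  unfolding gauss_eq by measurable

lemma measurable_gauss_norm [measurable]:
  "(\<lambda>g. \<Sum>i<n. (g i)\<^sup>2) \<in> borel_measurable (gauss n)"
  by (intro borel_measurable_sum borel_measurable_power measurable_gauss_component) auto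

lemma measurable_gauss_norm_diff [measurable]:
  "(\<lambda>g. \<Sum>i<n. (g i - y i)\<^sup>2) \<in> borel_measurable (gauss n)"
  by (intro borel_measurable_sum borel_measurable_power borel_measurable_diff
      measurable_gauss_component borel_measurable_const) auto

text \<open>The squared distance involves finitely many coordinates and is continuous in the product
  topology, so a dense subset has the same infimum. This serves to pass to closures, and to
  countable subsets for measurability.\<close>

lemma dist2_cong_closure:
  assumes "A \<noteq> {}" "A \<subseteq> C" "C \<subseteq> closure A"
  shows "dist2 n C x = dist2 n A x"
proof (rule antisym)
  show "dist2 n C x \<le> dist2 n A x" using assms by (intro dist2_antimono)
  have cont: "continuous_on UNIV (\<lambda>y :: nat \<Rightarrow> real. \<Sum>i<n. (x i - y i)\<^sup>2)"
    by (intro continuous_intros continuous_on_product_coordinates)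
  have "closed {y :: nat \<Rightarrow> real. dist2 n A x \<le> (\<Sum>i<n. (x i - y i)\<^sup>2)}"
    by (rule closed_Collect_le[OF continuous_on_const cont])
  moreover have "A \<subseteq> {y. dist2 n A x \<le> (\<Sum>i<n. (x i - y i)\<^sup>2)}"
    by (auto intro: dist2_lower)
  ultimately have "closure A \<subseteq> {y. dist2 n A x \<le> (\<Sum>i<n. (x i - y i)\<^sup>2)}"
    by (rule closure_minimal[rotated])
  then show "dist2 n A x \<le> dist2 n C x"
    using assms by (intro dist2_greatest) auto
qed

lemma measurable_dist2 [measurable]:
  assumes "C \<noteq> {}"
  shows "dist2 n C \<in> borel_measurable (gauss n)"
proof -
  obtain A where A: "countable A" "A \<subseteq> C" "C \<subseteq> closure A" by (rule separable)
  with assms have "A \<noteq> {}" by auto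
  have "(\<lambda>x. INF y\<in>A. \<Sum>i<n. (x i - y i)\<^sup>2) \<in> borel_measurable (gauss n)"
    using A(1) by (intro borel_measurable_cINF_real) auto
  also have "(\<lambda>x. INF y\<in>A. \<Sum>i<n. (x i - y i)\<^sup>2) = dist2 n C"
    using dist2_cong_closure[OF \<open>A \<noteq> {}\<close> A(2,3)] by (simp add: dist2_def fun_eq_iff)
  finally show ?thesis .
qed

lemma sets_dist2_prob [measurable]:
  assumes "C \<noteq> {}"
  shows "{g \<in> space (gauss n). (\<Sum>i<n. (g i)\<^sup>2) \<noteq> 0 \<and> dist2 n C g \<le> lam * (\<Sum>i<n. (g i)\<^sup>2)} \<in> sets (gauss n)"
proof -
  have "(\<lambda>g. lam * (\<Sum>i<n. (g i)\<^sup>2)) \<in> borel_measurable (gauss n)"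
    by (intro borel_measurable_times borel_measurable_const measurable_gauss_norm)
  then show ?thesis
    by (intro sets.sets_Collect_conj borel_measurable_neq borel_measurable_le measurable_gauss_norm
        measurable_dist2[OF assms] borel_measurable_const)
qed

lemma dist2_prob_isometry:
  assumes T: "gauss_isometry n T" and "C \<noteq> {}"
  shows "dist2_prob n {y. T y \<in> C} lam = dist2_prob n C lam"
proof -
  let ?S = "\<lambda>C. {g \<in> space (gauss n). (\<Sum>i<n. (g i)\<^sup>2) \<noteq> 0 \<and> dist2 n C g \<le> lam * (\<Sum>i<n. (g i)\<^sup>2)}"
  have meas: "T \<in> measurable (gauss n) (gauss n)" using T by (simp add: gauss_isometry_def)
  have "measure (gauss n) (?S C) = measure (distr (gauss n) (gauss n) T) (?S C)"
    using T by (simp add: gauss_isometry_def)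
  also have "\<dots> = measure (gauss n) (T -` ?S C \<inter> space (gauss n))"
    by (rule measure_distr[OF meas sets_dist2_prob[OF assms(2)]])
  also have "T -` ?S C \<inter> space (gauss n) = ?S {y. T y \<in> C}"
    using T measurable_space[OF meas] by (auto simp: dist2_vimage_isometry[OF T] gauss_isometry_def)
  finally show ?thesis by (simp add: dist2_prob_def)
qed

text \<open>Since the hypothesis holds for every \<open>f\<close> at every point, \<open>f\<close>
  may depend on the point: the indicator of \<open>d <= lam * |g|^2\<close> is chosen at each
  \<open>g\<close>. Integrating the resulting counts gives the probabilities.\<close>

lemma sum_list_dist2_prob:
  assumes ne: "\<And>C. C \<in> set Cs \<Longrightarrow> C \<noteq> {}" "\<And>C. C \<in> set Ds \<Longrightarrow> C \<noteq> {}"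
    and eq: "\<And>(f :: real \<Rightarrow> real) x. (\<Sum>C\<leftarrow>Cs. f (dist2 n C x)) = (\<Sum>C\<leftarrow>Ds. f (dist2 n C x))"
  shows "(\<Sum>C\<leftarrow>Cs. dist2_prob n C lam) = (\<Sum>C\<leftarrow>Ds. dist2_prob n C lam)"
proof -
  interpret prob_space "gauss n" by (rule prob_space_gauss)
  let ?S = "\<lambda>C. {g \<in> space (gauss n). (\<Sum>i<n. (g i)\<^sup>2) \<noteq> 0 \<and> dist2 n C g \<le> lam * (\<Sum>i<n. (g i)\<^sup>2)}"
  have int: "(\<Sum>C\<leftarrow>Cs. dist2_prob n C lam) =
      (LINT g|gauss n. (\<Sum>C\<leftarrow>Cs. indicator (?S C) g)) \<and> integrable (gauss n) (\<lambda>g. \<Sum>C\<leftarrow>Cs. indicator (?S C) g :: real)"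
    if "\<And>C. C \<in> set Cs \<Longrightarrow> C \<noteq> {}" for Cs
    using that
  proof (induction Cs)
    case (Cons C Cs)
    have [measurable]: "?S C \<in> sets (gauss n)" using Cons.prems by (intro sets_dist2_prob) auto
    have "integrable (gauss n) (indicator (?S C) :: _ \<Rightarrow> real)"
      by (intro integrable_real_indicator) (auto simp: emeasure_eq_measure)
    moreover have "dist2_prob n C lam = (LINT g|gauss n. indicator (?S C) g)"
      by (simp add: dist2_prob_def)
    ultimately show ?case using Cons by (simp del: Bochner_Integration.integral_indicator)
  qed simp
  have "(\<Sum>C\<leftarrow>Cs. indicator (?S C) g) = (\<Sum>C\<leftarrow>Ds. indicator (?S C) g :: real)"
    if "g \<in> space (gauss n)" for g
    using eq[of "\<lambda>d. of_bool ((\<Sum>i<n. (g i)\<^sup>2) \<noteq> 0 \<and> d \<le> lam * (\<Sum>i<n. (g i)\<^sup>2))" g] that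
    by (simp add: indicator_def)
  then show ?thesis using int[OF ne(1)] int[OF ne(2)]
    by (auto intro!: Bochner_Integration.integral_cong)
qed

text \<open>A planar reflection is split into two affine substitutions in one variable each, with
  Jacobian factors \<open>|1 / s|\<close> and \<open>|s|\<close> that cancel; hence the hypothesis
  that \<open>s\<close> is nonzero.\<close>

lemma nn_integral_lborel_reflection:
  fixes h :: "real \<Rightarrow> real \<Rightarrow> ennreal"
  assumes [measurable]: "case_prod h \<in> borel_measurable (borel \<Otimes>\<^sub>M borel)"
    and cs: "c\<^sup>2 + s\<^sup>2 = 1" "s \<noteq> 0"
  shows "(\<integral>\<^sup>+v. \<integral>\<^sup>+u. h (c * u + s * v) (s * u - c * v) \<partial>lborel \<partial>lborel) =
    (\<integral>\<^sup>+v. \<integral>\<^sup>+u. h u v \<partial>lborel \<partial>lborel)"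
proof -
  have cs': "c * c + s * s = 1" using cs by (simp add: power2_eq_square)
  have "(\<integral>\<^sup>+v. \<integral>\<^sup>+u. h u v \<partial>lborel \<partial>lborel) =
      (\<integral>\<^sup>+v. ennreal \<bar>1/s\<bar> * (\<integral>\<^sup>+u. h (c / s * v + 1/s * u) v \<partial>lborel) \<partial>lborel)"
    using cs(2) by (intro nn_integral_cong nn_integral_real_affine) auto
  also have "\<dots> = ennreal \<bar>1/s\<bar> * (\<integral>\<^sup>+v. \<integral>\<^sup>+u. h (c / s * v + 1/s * u) v \<partial>lborel \<partial>lborel)"
    by (rule nn_integral_cmult) measurable
  also have "(\<integral>\<^sup>+v. \<integral>\<^sup>+u. h (c / s * v + 1/s * u) v \<partial>lborel \<partial>lborel) =
      (\<integral>\<^sup>+u. \<integral>\<^sup>+v. h (c / s * v + 1/s * u) v \<partial>lborel \<partial>lborel)"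
    by (rule lborel_pair.Fubini') measurable
  also have "\<dots> = (\<integral>\<^sup>+u. ennreal \<bar>s\<bar> * (\<integral>\<^sup>+v. h (c / s * (- c * u + s * v) + 1/s * u) (- c * u + s * v) \<partial>lborel) \<partial>lborel)"
    using cs(2) by (intro nn_integral_cong nn_integral_real_affine) auto
  also have "\<dots> = ennreal \<bar>s\<bar> * (\<integral>\<^sup>+u. \<integral>\<^sup>+v. h (c / s * (- c * u + s * v) + 1/s * u) (- c * u + s * v) \<partial>lborel \<partial>lborel)"
    by (rule nn_integral_cmult) measurable
  also have "(\<integral>\<^sup>+u. \<integral>\<^sup>+v. h (c / s * (- c * u + s * v) + 1/s * u) (- c * u + s * v) \<partial>lborel \<partial>lborel) =
     (\<integral>\<^sup>+v. \<integral>\<^sup>+u. h (c * u + s * v) (s * u - c * v) \<partial>lborel \<partial>lborel)"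
  proof (intro nn_integral_cong)
    fix u v :: real
    have "c / s * (- c * u + s * v) + 1/s * u = (s * (c * v) + (1 - c * c) * u) / s"
      using cs(2) by (simp add: field_simps)
    also have "1 - c * c = s * s" using cs' by simp
    also have "(s * (c * v) + s * s * u) / s = c * v + s * u"
      using cs(2) by (simp add: field_simps)
    finally show "h (c / s * (- c * u + s * v) + 1/s * u) (- c * u + s * v) = h (c * v + s * u) (s * v - c * u)"
      by (simp add: algebra_simps)
  qed
  also have "ennreal \<bar>1/s\<bar> * (ennreal \<bar>s\<bar> * (\<integral>\<^sup>+v. \<integral>\<^sup>+u. h (c * u + s * v) (s * u - c * v) \<partial>lborel \<partial>lborel)) =
      (\<integral>\<^sup>+v. \<integral>\<^sup>+u. h (c * u + s * v) (s * u - c * v) \<partial>lborel \<partial>lborel)"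
    using cs(2) by (simp add: mult.assoc[symmetric] ennreal_mult'[symmetric])
  finally show ?thesis by simp
qed

lemma nn_integral_gauss1_reflection:
  fixes h :: "real \<Rightarrow> real \<Rightarrow> ennreal"
  assumes [measurable]: "case_prod h \<in> borel_measurable (borel \<Otimes>\<^sub>M borel)"
    and cs: "c\<^sup>2 + s\<^sup>2 = 1" "s \<noteq> 0"
  shows "(\<integral>\<^sup>+v. \<integral>\<^sup>+u. h (c * u + s * v) (s * u - c * v) \<partial>gauss1 \<partial>gauss1) =
    (\<integral>\<^sup>+v. \<integral>\<^sup>+u. h u v \<partial>gauss1 \<partial>gauss1)"
proof -
  define \<phi> where "\<phi> = (\<lambda>x. ennreal (std_normal_density x))"
  have [measurable]: "\<phi> \<in> borel_measurable borel" unfolding \<phi>_def by measurable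
  have conv: "(\<integral>\<^sup>+v. \<integral>\<^sup>+u. k u v \<partial>gauss1 \<partial>gauss1) =
      (\<integral>\<^sup>+v. \<integral>\<^sup>+u. \<phi> u * \<phi> v * k u v \<partial>lborel \<partial>lborel)"
    if [measurable]: "case_prod k \<in> borel_measurable (borel \<Otimes>\<^sub>M borel)" for k :: "real \<Rightarrow> real \<Rightarrow> ennreal"
  proof -
    have "(\<integral>\<^sup>+v. \<integral>\<^sup>+u. k u v \<partial>gauss1 \<partial>gauss1) = (\<integral>\<^sup>+v. \<phi> v * (\<integral>\<^sup>+u. \<phi> u * k u v \<partial>lborel) \<partial>lborel)"
      unfolding \<phi>_def by (simp add: nn_integral_gauss1)
    also have "\<dots> = (\<integral>\<^sup>+v. \<integral>\<^sup>+u. \<phi> u * \<phi> v * k u v \<partial>lborel \<partial>lborel)"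
      by (intro nn_integral_cong, subst nn_integral_cmult[symmetric]) (auto simp: mult_ac)
    finally show ?thesis .
  qed
  have inv: "\<phi> (c * u + s * v) * \<phi> (s * u - c * v) = \<phi> u * \<phi> v" for u v
  proof -
    have "(c * u + s * v)\<^sup>2 + (s * u - c * v)\<^sup>2 = (c\<^sup>2 + s\<^sup>2) * (u\<^sup>2 + v\<^sup>2)"
      by (simp add: power2_eq_square algebra_simps)
    then have "exp (- (c * u + s * v)\<^sup>2 / 2) * exp (- (s * u - c * v)\<^sup>2 / 2) = exp (- u\<^sup>2 / 2) * exp (- v\<^sup>2 / 2)"
      unfolding exp_add[symmetric] cs(1) by (simp add: field_simps)
    then have "std_normal_density (c * u + s * v) * std_normal_density (s * u - c * v) =
        std_normal_density u * std_normal_density v"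
      unfolding std_normal_density_def by (simp add: mult_ac)
    then show ?thesis by (simp add: \<phi>_def ennreal_mult'[symmetric])
  qed
  show ?thesis
    using nn_integral_lborel_reflection[of "\<lambda>u v. \<phi> u * \<phi> v * h u v" c s] cs
    by (simp add: conv inv)
qed

text \<open>A reflection rather than a rotation: for \<open>c^2 + s^2 = 1\<close> it is its own
  inverse, which gives surjectivity and lets old coordinates be expressed by new ones through the
  same formula.\<close>

definition plane_reflection :: "nat \<Rightarrow> nat \<Rightarrow> real \<Rightarrow> real \<Rightarrow> (nat \<Rightarrow> real) \<Rightarrow> nat \<Rightarrow> real" where
  "plane_reflection p j c s y = y(p := c * y p + s * y j, j := s * y p - c * y j)"

lemma plane_reflection_involution:
  assumes "p \<noteq> j" "c\<^sup>2 + s\<^sup>2 = 1"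
  shows "plane_reflection p j c s (plane_reflection p j c s y) = y"
proof -
  have "c * (c * u + s * v) + s * (s * u - c * v) = (c\<^sup>2 + s\<^sup>2) * u"
    "s * (c * u + s * v) - c * (s * u - c * v) = (c\<^sup>2 + s\<^sup>2) * v" for u v
    by (simp_all add: power2_eq_square algebra_simps)
  then show ?thesis using assms by (auto simp: plane_reflection_def fun_eq_iff)
qed

text \<open>Only the coordinates \<open>p\<close> and \<open>j\<close> move. The product integral is
  written with these two innermost, and for fixed other coordinates the planar invariance
  applies.\<close>

lemma gauss_isometry_plane_reflection:
  assumes pj: "p < n" "j < n" "p \<noteq> j" and cs: "c\<^sup>2 + s\<^sup>2 = 1" "s \<noteq> 0"
  shows "gauss_isometry n (plane_reflection p j c s)"
proof -
  let ?T = "plane_reflection p j c s"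
  define I where "I = {..<n} - {p, j}"
  have I: "finite I" "p \<notin> insert j I" "j \<notin> I" "insert p (insert j I) = {..<n}"
    using pj by (auto simp: I_def)
  have sq: "(\<Sum>i<n. f i) = (\<Sum>i\<in>I. f i) + f j + f p" for f :: "nat \<Rightarrow> real"
    unfolding I(4)[symmetric] using I(1-3) by simp
  have norm2: "(c * u + s * v)\<^sup>2 + (s * u - c * v)\<^sup>2 = u\<^sup>2 + v\<^sup>2" for u v
  proof -
    have "(c * u + s * v)\<^sup>2 + (s * u - c * v)\<^sup>2 = (c\<^sup>2 + s\<^sup>2) * (u\<^sup>2 + v\<^sup>2)"
      by (simp add: power2_eq_square algebra_simps)
    then show ?thesis using cs by simp
  qed
  have off: "i \<in> I \<Longrightarrow> ?T x i = x i" for x i by (auto simp: I_def plane_reflection_def)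
  have norm: "(\<Sum>i<n. (?T x i)\<^sup>2) = (\<Sum>i<n. (x i)\<^sup>2)" for x
    using pj norm2[of "x p" "x j"] by (simp add: sq off) (simp add: plane_reflection_def)
  have diff: "?T x i - ?T y i = ?T (\<lambda>i. x i - y i) i" for x y i
    by (simp add: plane_reflection_def algebra_simps)
  have meas [measurable]: "?T \<in> measurable (gauss n) (gauss n)"
    unfolding gauss_eq
  proof (rule measurable_PiM_single')
    fix i assume "i \<in> {..<n}"
    then have "(\<lambda>x. ?T x i) \<in> borel_measurable (gauss n)"
      using pj by (cases "i = j"; cases "i = p") (auto simp: plane_reflection_def
          intro!: borel_measurable_add borel_measurable_diff borel_measurable_times)
    then show "(\<lambda>x. ?T x i) \<in> measurable (PiM {..<n} (\<lambda>_. gauss1)) gauss1"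
      by (simp add: gauss_eq cong: measurable_cong_sets)
  next
    show "?T \<in> space (PiM {..<n} (\<lambda>_. gauss1)) \<rightarrow> {..<n} \<rightarrow>\<^sub>E space gauss1"
      using pj by (auto simp: space_PiM plane_reflection_def PiE_def extensional_def)
  qed
  have inv: "(\<integral>\<^sup>+x. f (?T x) \<partial>gauss n) = (\<integral>\<^sup>+x. f x \<partial>gauss n)"
    if f: "f \<in> borel_measurable (gauss n)" for f :: "(nat \<Rightarrow> real) \<Rightarrow> ennreal"
  proof -
    note [measurable] = f[unfolded gauss_eq, folded I(4)]
    have T [measurable]: "?T \<in> measurable (PiM (insert p (insert j I)) (\<lambda>_. gauss1)) (PiM (insert p (insert j I)) (\<lambda>_. gauss1))"
      using meas by (simp add: gauss_eq I(4))
    have fold: "(\<integral>\<^sup>+x. g x \<partial>gauss n) =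
        (\<integral>\<^sup>+x. \<integral>\<^sup>+v. \<integral>\<^sup>+u. g (x(j := v, p := u)) \<partial>gauss1 \<partial>gauss1 \<partial>PiM I (\<lambda>_. gauss1))"
      if [measurable]: "g \<in> borel_measurable (PiM (insert p (insert j I)) (\<lambda>_. gauss1))" for g :: "(nat \<Rightarrow> real) \<Rightarrow> ennreal"
    proof -
      have "(\<integral>\<^sup>+x. g x \<partial>gauss n) =
          (\<integral>\<^sup>+x. (\<integral>\<^sup>+u. g (x(p := u)) \<partial>gauss1) \<partial>PiM (insert j I) (\<lambda>_. gauss1))"
        unfolding gauss_eq I(4)[symmetric]
        by (rule gauss_prod.product_nn_integral_insert[OF _ _ that]) (use I(1-3) in auto)
      also have "\<dots> = (\<integral>\<^sup>+x. \<integral>\<^sup>+v. \<integral>\<^sup>+u. g (x(j := v, p := u)) \<partial>gauss1 \<partial>gauss1 \<partial>PiM I (\<lambda>_. gauss1))"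
        by (rule gauss_prod.product_nn_integral_insert[OF I(1,3)]) measurable
      finally show ?thesis .
    qed
    have "(\<integral>\<^sup>+x. f (?T x) \<partial>gauss n) = (\<integral>\<^sup>+x. \<integral>\<^sup>+v. \<integral>\<^sup>+u. f (?T (x(j := v, p := u))) \<partial>gauss1 \<partial>gauss1 \<partial>PiM I (\<lambda>_. gauss1))"
      by (rule fold) measurable
    also have "\<dots> = (\<integral>\<^sup>+x. \<integral>\<^sup>+v. \<integral>\<^sup>+u. f (x(j := v, p := u)) \<partial>gauss1 \<partial>gauss1 \<partial>PiM I (\<lambda>_. gauss1))"
    proof (rule nn_integral_cong)
      fix x assume x: "x \<in> space (PiM I (\<lambda>_. gauss1))"
      have T_upd: "?T (x(j := v, p := u)) = x(j := s * u - c * v, p := c * u + s * v)" for u v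
        using pj by (auto simp: plane_reflection_def fun_eq_iff)
      have "(\<lambda>z. x(j := snd z, p := fst z)) \<in>
          measurable (borel \<Otimes>\<^sub>M borel) (PiM (insert p (insert j I)) (\<lambda>_. gauss1))"
        by (rule measurable_fun_upd[where J = "insert j I"], simp, rule measurable_fun_upd[where J = I])
          (use x in \<open>auto cong: measurable_cong_sets\<close>)
      from measurable_compose[OF this f[unfolded gauss_eq, folded I(4)]]
      have "(\<lambda>(u, v). f (x(j := v, p := u))) \<in> borel_measurable (borel \<Otimes>\<^sub>M borel)"
        by (simp add: case_prod_beta')
      then show "(\<integral>\<^sup>+v. \<integral>\<^sup>+u. f (?T (x(j := v, p := u))) \<partial>gauss1 \<partial>gauss1) =
          (\<integral>\<^sup>+v. \<integral>\<^sup>+u. f (x(j := v, p := u)) \<partial>gauss1 \<partial>gauss1)"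
        unfolding T_upd
        using nn_integral_gauss1_reflection[of "\<lambda>u v. f (x(j := v, p := u))" c s] cs by simp
    qed
    also have "\<dots> = (\<integral>\<^sup>+x. f x \<partial>gauss n)"
      by (rule fold[symmetric]) measurable
    finally show ?thesis .
  qed
  have "distr (gauss n) (gauss n) ?T = gauss n"
  proof (rule measure_eqI)
    fix A assume "A \<in> sets (distr (gauss n) (gauss n) ?T)"
    then have A [measurable]: "A \<in> sets (gauss n)" by simp
    have "emeasure (distr (gauss n) (gauss n) ?T) A = (\<integral>\<^sup>+x. indicator A x \<partial>distr (gauss n) (gauss n) ?T)"
      by simp
    also have "\<dots> = (\<integral>\<^sup>+x. indicator A (?T x) \<partial>gauss n)"
      by (rule nn_integral_distr) measurable
    also have "\<dots> = emeasure (gauss n) A" by (subst inv) auto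
    finally show "emeasure (distr (gauss n) (gauss n) ?T) A = emeasure (gauss n) A" .
  qed simp
  moreover have "surj ?T"
    using plane_reflection_involution[OF pj(3) cs(1)] by (metis surj_def)
  ultimately show ?thesis
    unfolding gauss_isometry_def diff norm using meas by simp
qed

section \<open>The beta law for coordinate subspaces\<close>

lemma nn_integral_beta_kernel:
  assumes "0 < p" "0 < q"
  shows "(\<integral>\<^sup>+t. beta_kernel p q t \<partial>lborel) = ennreal (Beta p q)"
proof -
  have "((\<lambda>t. t powr (p - 1) * (1 - t) powr (q - 1)) has_integral Beta p q) {0<..<1}"
    using has_integral_Beta_real[OF assms] by (simp add: has_integral_Icc_iff_Ioo)
  then show ?thesis
    unfolding beta_kernel_def by (intro nn_integral_has_integral_lebesgue') auto
qed

lemma Beta_real_pos: "0 < p \<Longrightarrow> 0 < q \<Longrightarrow> 0 < Beta p (q :: real)"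
  by (simp add: Beta_def Gamma_real_pos)

lemma LBINT_beta_density:
  fixes lam :: real
  assumes "0 < lam"
  shows "(LBINT t=0..ereal (min lam 1). t powr (p - 1) * (1 - t) powr (q - 1)) =
    enn2real (\<integral>\<^sup>+t. indicator {..lam} t * beta_kernel p q t \<partial>lborel)"
proof -
  let ?f = "\<lambda>t::real. t powr (p - 1) * (1 - t) powr (q - 1)"
  let ?m = "min lam 1 :: real"
  have "(LBINT t=0..ereal ?m. ?f t) = (LINT t|lborel. indicator {0<..<?m} t * ?f t)"
    using assms einterval_eq_Icc[of 0 ?m]
    by (simp add: interval_lebesgue_integral_def set_lebesgue_integral_def zero_ereal_def)
  also have "\<dots> = enn2real (\<integral>\<^sup>+t. ennreal (indicator {0<..<?m} t * ?f t) \<partial>lborel)"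
    by (rule integral_eq_nn_integral) auto
  also have "(\<integral>\<^sup>+t. ennreal (indicator {0<..<?m} t * ?f t) \<partial>lborel) =
      (\<integral>\<^sup>+t. indicator {..lam} t * beta_kernel p q t \<partial>lborel)"
    by (intro nn_integral_cong_AE eventually_mono[OF AE_lborel_singleton[of lam]])
      (auto simp: beta_kernel_def split: split_indicator)
  finally show ?thesis .
qed

lemma beta_cdf_nn_integral:
  assumes "0 < p" "0 < q"
  shows "beta_cdf p q lam = enn2real (\<integral>\<^sup>+t. indicator {..lam} t * beta_kernel p q t \<partial>lborel) / Beta p q"
proof (cases "0 < lam")
  case True
  then show ?thesis using assms LBINT_beta_density[OF True, of p q] by (simp add: beta_cdf_def)
next
  case False
  then have z: "indicator {..lam} t * beta_kernel p q t = 0" for t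
    by (auto simp: beta_kernel_def split: split_indicator)
  show ?thesis using assms False by (simp add: beta_cdf_def z)
qed

lemma nn_integral_gauss_split:
  assumes Z: "Z \<subseteq> {..<n}"
    and h [measurable]: "case_prod h \<in> borel_measurable (borel \<Otimes>\<^sub>M borel)"
  shows "(\<integral>\<^sup>+g. h (\<Sum>i\<in>Z. (g i)\<^sup>2) (\<Sum>i\<in>{..<n} - Z. (g i)\<^sup>2) \<partial>gauss n) =
    (\<integral>\<^sup>+x. \<integral>\<^sup>+y. h (\<Sum>i\<in>Z. (x i)\<^sup>2) (\<Sum>i\<in>{..<n} - Z. (y i)\<^sup>2)
      \<partial>PiM ({..<n} - Z) (\<lambda>_. gauss1) \<partial>PiM Z (\<lambda>_. gauss1))"
proof -
  define W where "W = {..<n} - Z"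
  have ZW: "Z \<inter> W = {}" "finite Z" "finite W" "Z \<union> W = {..<n}"
    using Z finite_subset by (auto simp: W_def)
  let ?H = "\<lambda>g. h (\<Sum>i\<in>Z. (g i)\<^sup>2) (\<Sum>i\<in>W. (g i)\<^sup>2)"
  have sumsq [measurable]: "(\<lambda>g. \<Sum>i\<in>A. (g i)\<^sup>2) \<in> borel_measurable (gauss n)" if "A \<subseteq> {..<n}" for A
    using that by (intro borel_measurable_sum borel_measurable_power measurable_gauss_component) auto
  have "(\<lambda>g. (\<Sum>i\<in>Z. (g i)\<^sup>2, \<Sum>i\<in>W. (g i)\<^sup>2)) \<in> measurable (gauss n) (borel \<Otimes>\<^sub>M borel)"
    by (intro measurable_Pair sumsq) (use ZW(4) in auto)
  from measurable_compose[OF this h]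
  have "?H \<in> borel_measurable (PiM (Z \<union> W) (\<lambda>_. gauss1))"
    by (simp add: gauss_eq ZW(4))
  from gauss_prod.product_nn_integral_fold[OF ZW(1-3) this]
  have "(\<integral>\<^sup>+g. ?H g \<partial>gauss n) = (\<integral>\<^sup>+x. \<integral>\<^sup>+y. ?H (merge Z W (x, y)) \<partial>PiM W (\<lambda>_. gauss1) \<partial>PiM Z (\<lambda>_. gauss1))"
    by (simp add: gauss_eq ZW(4))
  moreover have "(\<Sum>i\<in>W. (merge Z W (x, y) i)\<^sup>2) = (\<Sum>i\<in>W. (y i)\<^sup>2)" for x y :: "nat \<Rightarrow> real"
    by (intro sum.cong) (auto simp: W_def merge_def)
  ultimately show ?thesis by (simp add: merge_def W_def)
qed

text \<open>The kernel of the law of \<open>|g|^2\<close> is 0 at 0, so the integral of the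
  indicator of \<open>{0}\<close> vanishes whatever the constant in front.\<close>

lemma AE_gauss_nonzero:
  assumes "1 \<le> n"
  shows "AE g in gauss n. (\<Sum>i<n. (g i)\<^sup>2) \<noteq> 0"
proof -
  obtain c where c: "\<And>h. h \<in> borel_measurable borel \<Longrightarrow>
    (\<integral>\<^sup>+x. h (\<Sum>i<n. (x i)\<^sup>2) \<partial>gauss n) = c * (\<integral>\<^sup>+t. h t * gamma_kernel (card {..<n} / 2) t \<partial>lborel)"
    using chi_square_law[of "{..<n}"] assms unfolding gauss_eq by (auto simp: lessThan_empty_iff)
  have z: "indicator {0} t * gamma_kernel r t = 0" for t r
    by (auto simp: gamma_kernel_def split: split_indicator)
  have "(\<integral>\<^sup>+x. indicator {0} (\<Sum>i<n. (x i)\<^sup>2) \<partial>gauss n) = 0"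
    by (subst c) (auto simp: z)
  then have "AE x in gauss n. indicator {0} (\<Sum>i<n. (x i)\<^sup>2) = (0 :: ennreal)"
    by (subst (asm) nn_integral_0_iff_AE) measurable
  then show ?thesis by eventually_elim (auto split: split_indicator_asm)
qed

lemma dist2_coordinate_subspace:
  assumes "Z \<subseteq> {..<n}"
  shows "dist2 n {y. \<forall>q\<in>Z. y q = 0} x = (\<Sum>q\<in>Z. (x q)\<^sup>2)"
proof (rule antisym)
  let ?L = "{y :: nat \<Rightarrow> real. \<forall>q\<in>Z. y q = 0}"
  have split: "(\<Sum>i<n. f i) = (\<Sum>i\<in>Z. f i) + (\<Sum>i\<in>{..<n} - Z. f i)" for f :: "nat \<Rightarrow> real"
    using sum.subset_diff[OF assms, of f] by simp
  have "dist2 n ?L x \<le> (\<Sum>i<n. (x i - (if i \<in> Z then 0 else x i))\<^sup>2)"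
    by (rule dist2_lower) auto
  also have "\<dots> = (\<Sum>q\<in>Z. (x q)\<^sup>2)" by (simp add: split)
  finally show "dist2 n ?L x \<le> (\<Sum>q\<in>Z. (x q)\<^sup>2)" .
  show "(\<Sum>q\<in>Z. (x q)\<^sup>2) \<le> dist2 n ?L x"
  proof (rule dist2_greatest)
    fix y assume "y \<in> ?L"
    then have "(\<Sum>q\<in>Z. (x q)\<^sup>2) = (\<Sum>q\<in>Z. (x q - y q)\<^sup>2)" by (intro sum.cong) auto
    also have "\<dots> \<le> (\<Sum>i<n. (x i - y i)\<^sup>2)" by (simp add: split sum_nonneg)
    finally show "(\<Sum>q\<in>Z. (x q)\<^sup>2) \<le> (\<Sum>i<n. (x i - y i)\<^sup>2)" .
  qed auto
qed

text \<open>The two sums of squares are independent with gamma kernels of parameters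
  \<open>card Z / 2\<close> and \<open>card W / 2\<close>, so the share of the first in the total
  has the beta kernel with these parameters. The unknown constants merge into \<open>K\<close>,
  which is fixed by \<open>lam = 1\<close>, where the event is the whole space.\<close>

lemma gauss_ratio_law:
  assumes Z: "Z \<subseteq> {..<n}" "Z \<noteq> {}" "Z \<noteq> {..<n}"
  defines "W \<equiv> {..<n} - Z"
  shows "measure (gauss n) {g \<in> space (gauss n).
      (\<Sum>i\<in>Z. (g i)\<^sup>2) / ((\<Sum>i\<in>Z. (g i)\<^sup>2) + (\<Sum>i\<in>W. (g i)\<^sup>2)) \<le> lam} =
    beta_cdf (card Z / 2) (card W / 2) lam"
proof -
  interpret prob_space "gauss n" by (rule prob_space_gauss)
  have fin: "finite Z" "finite W" "W \<noteq> {}"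
    using Z by (auto simp: W_def intro: finite_subset)
  then have pos: "0 < card Z / 2" "0 < card W / 2" using Z(2) by (auto simp: card_gt_0_iff)
  let ?p = "card Z / 2" and ?q = "card W / 2"
  obtain cZ where cZ: "\<And>h. h \<in> borel_measurable borel \<Longrightarrow>
    (\<integral>\<^sup>+x. h (\<Sum>i\<in>Z. (x i)\<^sup>2) \<partial>PiM Z (\<lambda>_. gauss1)) = cZ * (\<integral>\<^sup>+t. h t * gamma_kernel ?p t \<partial>lborel)"
    using chi_square_law[OF fin(1) Z(2)] by blast
  obtain cW where cW: "\<And>h. h \<in> borel_measurable borel \<Longrightarrow>
    (\<integral>\<^sup>+x. h (\<Sum>i\<in>W. (x i)\<^sup>2) \<partial>PiM W (\<lambda>_. gauss1)) = cW * (\<integral>\<^sup>+t. h t * gamma_kernel ?q t \<partial>lborel)"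
    using chi_square_law[OF fin(2,3)] by blast
  let ?S = "\<lambda>lam. {g \<in> space (gauss n).
      (\<Sum>i\<in>Z. (g i)\<^sup>2) / ((\<Sum>i\<in>Z. (g i)\<^sup>2) + (\<Sum>i\<in>W. (g i)\<^sup>2)) \<le> lam}"
  define K where "K = cZ * cW * (\<integral>\<^sup>+s. gamma_kernel (?p + ?q) s \<partial>lborel)"
  have sumsq [measurable]: "(\<lambda>g. \<Sum>i\<in>A. (g i)\<^sup>2) \<in> borel_measurable (gauss n)" if "A \<subseteq> {..<n}" for A
    using that by (intro borel_measurable_sum borel_measurable_power measurable_gauss_component) auto
  have main: "emeasure (gauss n) (?S lam) = K * (\<integral>\<^sup>+t. indicator {..lam} t * beta_kernel ?p ?q t \<partial>lborel)" for lam
  proof -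
    have S [measurable]: "?S lam \<in> sets (gauss n)"
      using Z(1) by (intro borel_measurable_le borel_measurable_divide borel_measurable_add sumsq) (auto simp: W_def)
    have "emeasure (gauss n) (?S lam) = (\<integral>\<^sup>+g. indicator (?S lam) g \<partial>gauss n)"
      by simp
    also have "\<dots> = (\<integral>\<^sup>+g. indicator {..lam} ((\<Sum>i\<in>Z. (g i)\<^sup>2) / ((\<Sum>i\<in>Z. (g i)\<^sup>2) + (\<Sum>i\<in>W. (g i)\<^sup>2))) \<partial>gauss n)"
      by (intro nn_integral_cong) (auto split: split_indicator)
    also have "\<dots> = (\<integral>\<^sup>+x. \<integral>\<^sup>+y. indicator {..lam} ((\<Sum>i\<in>Z. (x i)\<^sup>2) / ((\<Sum>i\<in>Z. (x i)\<^sup>2) + (\<Sum>i\<in>W. (y i)\<^sup>2)))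
        \<partial>PiM W (\<lambda>_. gauss1) \<partial>PiM Z (\<lambda>_. gauss1))"
      unfolding W_def using nn_integral_gauss_split[OF Z(1), of "\<lambda>x y. indicator {..lam} (x / (x + y))"] by simp
    also have "\<dots> = (\<integral>\<^sup>+x. cW * (\<integral>\<^sup>+y. indicator {..lam} ((\<Sum>i\<in>Z. (x i)\<^sup>2) / ((\<Sum>i\<in>Z. (x i)\<^sup>2) + y)) * gamma_kernel ?q y \<partial>lborel) \<partial>PiM Z (\<lambda>_. gauss1))"
      by (intro nn_integral_cong cW[of "\<lambda>y. indicator {..lam} (_ / (_ + y))"]) measurable
    also have "\<dots> = cZ * (\<integral>\<^sup>+x. cW * (\<integral>\<^sup>+y. indicator {..lam} (x / (x + y)) * gamma_kernel ?q y \<partial>lborel) * gamma_kernel ?p x \<partial>lborel)"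
      by (rule cZ) measurable
    also have "\<dots> = cZ * (\<integral>\<^sup>+x. cW * (\<integral>\<^sup>+y. indicator {..lam} (x / (x + y)) * (gamma_kernel ?p x * gamma_kernel ?q y) \<partial>lborel) \<partial>lborel)"
    proof (rule arg_cong[where f = "(*) cZ"], rule nn_integral_cong)
      fix x :: real
      have "(\<integral>\<^sup>+y. indicator {..lam} (x / (x + y)) * gamma_kernel ?q y \<partial>lborel) * gamma_kernel ?p x =
        (\<integral>\<^sup>+y. indicator {..lam} (x / (x + y)) * (gamma_kernel ?p x * gamma_kernel ?q y) \<partial>lborel)"
        by (subst nn_integral_multc[symmetric]) (auto simp: mult_ac)
      then show "cW * (\<integral>\<^sup>+y. indicator {..lam} (x / (x + y)) * gamma_kernel ?q y \<partial>lborel) * gamma_kernel ?p x =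
        cW * (\<integral>\<^sup>+y. indicator {..lam} (x / (x + y)) * (gamma_kernel ?p x * gamma_kernel ?q y) \<partial>lborel)"
        by (simp add: mult.assoc)
    qed
    also have "\<dots> = cZ * (cW * (\<integral>\<^sup>+x. \<integral>\<^sup>+y. indicator {..lam} (x / (x + y)) * (gamma_kernel ?p x * gamma_kernel ?q y) \<partial>lborel \<partial>lborel))"
      by (subst nn_integral_cmult) auto
    also have "(\<integral>\<^sup>+x. \<integral>\<^sup>+y. indicator {..lam} (x / (x + y)) * (gamma_kernel ?p x * gamma_kernel ?q y) \<partial>lborel \<partial>lborel) =
        (\<integral>\<^sup>+s. \<integral>\<^sup>+t. indicator {..lam} t * (gamma_kernel (?p + ?q) s * beta_kernel ?p ?q t) \<partial>lborel \<partial>lborel)"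
      by (rule nn_integral_gamma_beta[of "\<lambda>s t. indicator {..lam} t"]) measurable
    also have "\<dots> = (\<integral>\<^sup>+s. gamma_kernel (?p + ?q) s * (\<integral>\<^sup>+t. indicator {..lam} t * beta_kernel ?p ?q t \<partial>lborel) \<partial>lborel)"
      by (intro nn_integral_cong, subst nn_integral_cmult[symmetric]) (auto simp: mult_ac)
    also have "\<dots> = (\<integral>\<^sup>+s. gamma_kernel (?p + ?q) s \<partial>lborel) * (\<integral>\<^sup>+t. indicator {..lam} t * beta_kernel ?p ?q t \<partial>lborel)"
      by (rule nn_integral_multc) simp
    finally show ?thesis by (simp add: K_def mult_ac)
  qed
  let ?B = "Beta ?p ?q"
  have B: "0 < ?B" by (rule Beta_real_pos[OF pos])
  \<comment> \<open>If the denominator is 0, so is the quotient; hence \<open>lam = 1\<close>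
    excludes no point.\<close>
  have "a / (a + b) \<le> 1" if "0 \<le> a" "0 \<le> b" for a b :: real
    using that by (cases "a + b = 0") (auto simp: divide_le_eq_1)
  then have "?S 1 = space (gauss n)" by (simp add: sum_nonneg)
  then have "1 = K * (\<integral>\<^sup>+t. indicator {..1} t * beta_kernel ?p ?q t \<partial>lborel)"
    using main[of 1] by (simp add: emeasure_space_1)
  also have "(\<integral>\<^sup>+t. indicator {..1} t * beta_kernel ?p ?q t \<partial>lborel) = (\<integral>\<^sup>+t. beta_kernel ?p ?q t \<partial>lborel)"
    by (intro nn_integral_cong) (auto simp: beta_kernel_def split: split_indicator)
  also have "\<dots> = ennreal ?B" by (rule nn_integral_beta_kernel[OF pos])
  finally have KB: "K * ennreal ?B = 1" ..
  then have "enn2real K * ?B = 1"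
    using B by (metis enn2real_1 enn2real_ennreal enn2real_mult less_imp_le)
  then have K: "enn2real K = 1 / ?B" using B by (simp add: field_simps)
  show ?thesis
    using main[of lam] by (simp add: measure_def enn2real_mult K beta_cdf_nn_integral[OF pos])
qed

text \<open>The extreme dimensions carry point masses: for \<open>k = n\<close> the distance is 0,
  for \<open>k = 0\<close> the ratio is 1. These are the conventions for \<open>a = 0\<close> and
  \<open>b = 0\<close> in \<open>beta_cdf\<close>. In between, the second parameter
  \<open>k / 2\<close> counts the coordinates outside \<open>Z\<close>.\<close>

lemma dist2_prob_coordinate_subspace:
  assumes Z: "Z \<subseteq> {..<n}" and k: "k \<le> n" "card Z = n - k" and n: "1 \<le> n" and lam: "0 \<le> lam"
  shows "dist2_prob n {y. \<forall>q\<in>Z. y q = 0} lam = beta_kn k n lam"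
proof -
  interpret prob_space "gauss n" by (rule prob_space_gauss)
  note AE = AE_gauss_nonzero[OF n]
  have nn: "0 \<le> (\<Sum>i<n. (g i)\<^sup>2)" for g :: "nat \<Rightarrow> real" by (simp add: sum_nonneg)
  have prob: "dist2_prob n {y. \<forall>q\<in>Z. y q = 0} lam =
      measure (gauss n) {g \<in> space (gauss n). (\<Sum>i<n. (g i)\<^sup>2) \<noteq> 0 \<and> (\<Sum>q\<in>Z. (g q)\<^sup>2) \<le> lam * (\<Sum>i<n. (g i)\<^sup>2)}"
    by (simp add: dist2_prob_def dist2_coordinate_subspace[OF Z])
  have one: "measure (gauss n) {g \<in> space (gauss n). (\<Sum>i<n. (g i)\<^sup>2) \<noteq> 0} = 1"
    using AE by (subst prob_Collect_eq_1) (auto intro!: borel_measurable_neq)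
  have finZ: "finite Z" using Z finite_subset by blast
  consider "Z = {}" | "Z \<noteq> {}" "Z = {..<n}" | "Z \<noteq> {}" "Z \<noteq> {..<n}" by blast
  then show ?thesis
  proof cases
    case 1
    then have "k = n" using k by simp
    then show ?thesis unfolding prob using 1 lam one nn by (simp add: beta_kn_def beta_cdf_def)
  next
    case 2
    then have "k = 0" using k n by simp
    have iff: "(s \<noteq> 0 \<and> s \<le> lam * s) = (s \<noteq> 0 \<and> 1 \<le> lam)" if "0 \<le> s" for s
      using that by (auto simp: mult_le_cancel_right1 less_le)
    then have "{g \<in> space (gauss n). (\<Sum>i<n. (g i)\<^sup>2) \<noteq> 0 \<and> (\<Sum>i<n. (g i)\<^sup>2) \<le> lam * (\<Sum>i<n. (g i)\<^sup>2)} =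
        (if 1 \<le> lam then {g \<in> space (gauss n). (\<Sum>i<n. (g i)\<^sup>2) \<noteq> 0} else {})"
      using nn by auto
    then show ?thesis
      unfolding 2(2) prob[unfolded 2(2)] using one n \<open>k = 0\<close> by (simp add: beta_kn_def beta_cdf_def)
  next
    case 3
    define W where "W = {..<n} - Z"
    have "card W = k"
      using k card_Diff_subset[OF finZ Z] by (simp add: W_def)
    have split: "(\<Sum>i<n. f i) = (\<Sum>i\<in>Z. f i) + (\<Sum>i\<in>W. f i)" for f :: "nat \<Rightarrow> real"
      using sum.subset_diff[OF Z, of f] by (simp add: W_def)
    have sumsq: "(\<lambda>g. \<Sum>i\<in>A. (g i)\<^sup>2) \<in> borel_measurable (gauss n)" if "A \<subseteq> {..<n}" for A
      using that by (intro borel_measurable_sum borel_measurable_power measurable_gauss_component) auto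
    have "dist2_prob n {y. \<forall>q\<in>Z. y q = 0} lam = measure (gauss n) {g \<in> space (gauss n).
        (\<Sum>i\<in>Z. (g i)\<^sup>2) / ((\<Sum>i\<in>Z. (g i)\<^sup>2) + (\<Sum>i\<in>W. (g i)\<^sup>2)) \<le> lam}"
      unfolding prob split[symmetric]
    proof (rule finite_measure_eq_AE)
      show "AE g in gauss n. (g \<in> {g \<in> space (gauss n). (\<Sum>i<n. (g i)\<^sup>2) \<noteq> 0 \<and> (\<Sum>q\<in>Z. (g q)\<^sup>2) \<le> lam * (\<Sum>i<n. (g i)\<^sup>2)}) =
        (g \<in> {g \<in> space (gauss n). (\<Sum>i\<in>Z. (g i)\<^sup>2) / (\<Sum>i<n. (g i)\<^sup>2) \<le> lam})"
        using AE
      proof eventually_elim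
        case (elim g)
        then have "0 < (\<Sum>i<n. (g i)\<^sup>2)" using nn[of g] by simp
        then show ?case by (auto simp: pos_divide_le_eq)
      qed
      show "{g \<in> space (gauss n). (\<Sum>i<n. (g i)\<^sup>2) \<noteq> 0 \<and> (\<Sum>q\<in>Z. (g q)\<^sup>2) \<le> lam * (\<Sum>i<n. (g i)\<^sup>2)} \<in> sets (gauss n)"
        using Z by (intro sets.sets_Collect_conj borel_measurable_neq borel_measurable_le
            borel_measurable_times borel_measurable_const sumsq) auto
      show "{g \<in> space (gauss n). (\<Sum>i\<in>Z. (g i)\<^sup>2) / (\<Sum>i<n. (g i)\<^sup>2) \<le> lam} \<in> sets (gauss n)"
        using Z by (intro borel_measurable_le borel_measurable_divide borel_measurable_const sumsq) auto
    qed
    also have "\<dots> = beta_cdf (card Z / 2) (card W / 2) lam"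
      using gauss_ratio_law[OF Z 3] by (simp add: W_def)
    finally show ?thesis
      using k \<open>card W = k\<close> by (simp add: beta_kn_def of_nat_diff)
  qed
qed

section \<open>Signed permutations and flats\<close>

lemma emeasure_gauss1_sign:
  assumes "s = 1 \<or> s = -1" and B: "B \<in> sets borel"
  shows "{u. s * u \<in> B} \<in> sets borel \<and> emeasure gauss1 {u. s * u \<in> B} = emeasure gauss1 B"
proof -
  have meas: "{u. s * u \<in> B} \<in> sets borel"
    using measurable_sets[of "\<lambda>u. s * u" borel borel B] B by (simp add: vimage_def)
  have "emeasure gauss1 {u. s * u \<in> B} = (\<integral>\<^sup>+u. ennreal (std_normal_density u) * indicator B (s * u) \<partial>lborel)"
    using meas by (subst nn_integral_indicator[symmetric], simp, subst nn_integral_gauss1)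
      (auto intro!: nn_integral_cong split: split_indicator)
  also have "\<dots> = (\<integral>\<^sup>+u. ennreal (std_normal_density u) * indicator B u \<partial>lborel)"
    using B assms(1) by (subst (2) nn_integral_real_affine[where c = s and t = 0])
      (auto simp: std_normal_density_def)
  also have "\<dots> = emeasure gauss1 B"
    using B by (subst nn_integral_indicator[symmetric], simp, subst nn_integral_gauss1) auto
  finally show ?thesis using meas by simp
qed

text \<open>The \<open>i\<close>-th form of the list becomes the \<open>i\<close>-th coordinate, so
  the cone of \<open>zs\<close> is the preimage of the cone of the standard chain. Coordinates
  beyond the list are kept, so that a signed permutation acts surjectively on all functions.\<close>

definition signed_coords :: "(real \<times> nat) list \<Rightarrow> (nat \<Rightarrow> real) \<Rightarrow> nat \<Rightarrow> real" where
  "signed_coords zs y = (\<lambda>i. if i < length zs then form_val y (zs ! i) else y i)"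

definition signed_permutation :: "nat \<Rightarrow> (real \<times> nat) list \<Rightarrow> bool" where
  "signed_permutation n zs \<longleftrightarrow> mset (map snd zs) = mset [0..<n] \<and> fst ` set zs \<subseteq> {1, -1}"

lemma signed_permutation_length: "signed_permutation n zs \<Longrightarrow> length zs = n"
  unfolding signed_permutation_def by (metis length_map length_upt diff_zero mset_eq_length)

lemma map_form_val_signed_coords:
  assumes "length zs = n"
  shows "map (form_val (signed_coords zs y)) (map (Pair 1) [0..<n]) = map (form_val y) zs"
  using assms by (intro nth_equalityI) (auto simp: form_val_def signed_coords_def)

lemma gauss_isometry_signed_coords:
  assumes zs: "signed_permutation n zs"
  shows "gauss_isometry n (signed_coords zs)"
proof -
  let ?T = "signed_coords zs"
  define s \<pi> where "s i = fst (zs ! i)" and "\<pi> i = snd (zs ! i)" for i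
  have len: "length zs = n" by (rule signed_permutation_length[OF zs])
  have T: "?T y i = (if i < n then s i * y (\<pi> i) else y i)" for y i
    by (simp add: signed_coords_def form_val_def s_def \<pi>_def len)
  have s: "s i = 1 \<or> s i = -1" if "i < n" for i
    using zs that len by (auto simp: signed_permutation_def s_def subset_iff)
  have "distinct (map snd zs)" "set (map snd zs) = {..<n}"
    using zs unfolding signed_permutation_def
    by (metis distinct_upt mset_eq_imp_distinct_iff) (metis zs signed_permutation_def atLeast_upt mset_eq_setD)
  then have "bij_betw ((!) (map snd zs)) {..<n} {..<n}"
    by (intro bij_betw_nth) (auto simp: len)
  then have bij: "bij_betw \<pi> {..<n} {..<n}"
    by (rule bij_betw_cong[THEN iffD1, rotated]) (auto simp: \<pi>_def len)
  define \<rho> where "\<rho> = inv_into {..<n} \<pi>"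
  have \<rho>: "\<rho> (\<pi> i) = i" "\<pi> i < n" "\<pi> (\<rho> i) = i" "\<rho> i < n" if "i < n" for i
    using that bij_betw_inv_into_left[OF bij, of i] bij_betw_inv_into_right[OF bij, of i]
      bij_betw_apply[OF bij, of i] bij_betw_apply[OF bij_betw_inv_into[OF bij], of i]
    by (auto simp: \<rho>_def)
  have bij': "bij_betw \<rho> {..<n} {..<n}" unfolding \<rho>_def by (rule bij_betw_inv_into[OF bij])
  have meas: "?T \<in> measurable (gauss n) (gauss n)"
    unfolding gauss_eq
  proof (rule measurable_PiM_single')
    fix i assume "i \<in> {..<n}"
    then have "(\<lambda>x. ?T x i) \<in> borel_measurable (gauss n)"
      using \<rho>(2) by (auto simp: T intro!: borel_measurable_times)
    then show "(\<lambda>x. ?T x i) \<in> measurable (PiM {..<n} (\<lambda>_. gauss1)) gauss1"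
      by (simp add: gauss_eq cong: measurable_cong_sets)
  next
    show "?T \<in> space (PiM {..<n} (\<lambda>_. gauss1)) \<rightarrow> {..<n} \<rightarrow>\<^sub>E space gauss1"
      by (auto simp: space_PiM T PiE_def extensional_def)
  qed
  have "distr (gauss n) (gauss n) ?T = PiM {..<n} (\<lambda>_. gauss1)"
  proof (rule gauss_prod.PiM_eqI)
    fix A :: "nat \<Rightarrow> real set" assume "\<And>i. i \<in> {..<n} \<Longrightarrow> A i \<in> sets gauss1"
    then have A: "A i \<in> sets borel" if "i < n" for i using that by auto
    \<comment> \<open>\<open>\<rho>\<close> inverts \<open>\<pi>\<close>: the coordinate
      \<open>j\<close> of a point is read by the coordinate \<open>\<rho> j\<close> of its image, so
      preimages of boxes are boxes with sides permuted and possibly reflected.\<close>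
    let ?A = "\<lambda>j. {u. s (\<rho> j) * u \<in> A (\<rho> j)}"
    have A': "?A j \<in> sets borel" "emeasure gauss1 (?A j) = emeasure gauss1 (A (\<rho> j))" if "j < n" for j
      using emeasure_gauss1_sign[OF s A, of "\<rho> j" "\<rho> j"] \<rho>(4)[OF that] by auto
    have "Pi\<^sub>E {..<n} A \<in> sets (gauss n)"
      unfolding gauss_eq using A by (intro sets_PiM_I_finite) auto
    then have "emeasure (distr (gauss n) (gauss n) ?T) (Pi\<^sub>E {..<n} A) =
        emeasure (gauss n) (?T -` Pi\<^sub>E {..<n} A \<inter> space (gauss n))"
      by (rule emeasure_distr[OF meas])
    also have "?T -` Pi\<^sub>E {..<n} A \<inter> space (gauss n) = Pi\<^sub>E {..<n} ?A"
    proof (intro set_eqI iffI)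
      fix x assume "x \<in> ?T -` Pi\<^sub>E {..<n} A \<inter> space (gauss n)"
      then have *: "x \<in> extensional {..<n}" "\<And>i. i < n \<Longrightarrow> s i * x (\<pi> i) \<in> A i"
        by (auto simp: space_gauss PiE_def Pi_def T)
      have "s (\<rho> j) * x j \<in> A (\<rho> j)" if "j < n" for j
        using *(2)[OF \<rho>(4)[OF that]] \<rho>(3)[OF that] by simp
      then show "x \<in> Pi\<^sub>E {..<n} ?A" using *(1) by (auto simp: PiE_def)
    next
      fix x assume "x \<in> Pi\<^sub>E {..<n} ?A"
      then have *: "x \<in> extensional {..<n}" "\<And>j. j < n \<Longrightarrow> s (\<rho> j) * x j \<in> A (\<rho> j)"
        by (auto simp: PiE_def Pi_def)
      have "s i * x (\<pi> i) \<in> A i" if "i < n" for i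
        using *(2)[of "\<pi> i"] \<rho>[OF that] by simp
      then show "x \<in> ?T -` Pi\<^sub>E {..<n} A \<inter> space (gauss n)"
        using *(1) by (auto simp: space_gauss PiE_def T extensional_def)
    qed
    also have "emeasure (gauss n) (Pi\<^sub>E {..<n} ?A) = (\<Prod>j<n. emeasure gauss1 (?A j))"
      unfolding gauss_eq using A' by (intro gauss_prod.emeasure_PiM) auto
    also have "\<dots> = (\<Prod>j<n. emeasure gauss1 (A (\<rho> j)))" using A' by simp
    also have "\<dots> = (\<Prod>i<n. emeasure gauss1 (A i))"
      by (rule prod.reindex_bij_betw[OF bij'])
    finally show "emeasure (distr (gauss n) (gauss n) ?T) (Pi\<^sub>E {..<n} A) = (\<Prod>i<n. emeasure gauss1 (A i))" .
  qed (auto simp: gauss_eq)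
  then have distr: "distr (gauss n) (gauss n) ?T = gauss n" by (simp add: gauss_eq)
  have s2: "s i * s i = 1" if "i < n" for i using s[OF that] by auto
  have sq: "(\<Sum>i<n. (s i * x (\<pi> i))\<^sup>2) = (\<Sum>i<n. (x i)\<^sup>2)" for x
  proof -
    have "(\<Sum>i<n. (s i * x (\<pi> i))\<^sup>2) = (\<Sum>i<n. (x (\<pi> i))\<^sup>2)"
      using s2 by (intro sum.cong) (auto simp: power_mult_distrib power2_eq_square)
    then show ?thesis using sum.reindex_bij_betw[OF bij, of "\<lambda>i. (x i)\<^sup>2"] by simp
  qed
  have "(\<Sum>i<n. (?T x i - ?T y i)\<^sup>2) = (\<Sum>i<n. (x i - y i)\<^sup>2)" for x y
    using sq[of "\<lambda>i. x i - y i"] by (simp add: T algebra_simps)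
  moreover have "(\<Sum>i<n. (?T x i)\<^sup>2) = (\<Sum>i<n. (x i)\<^sup>2)" for x
    using sq[of x] by (simp add: T)
  moreover have "surj ?T"
  proof (rule surjI)
    fix z
    show "?T (\<lambda>j. if j < n then s (\<rho> j) * z (\<rho> j) else z j) = z"
      using \<rho> s2 by (auto simp: T fun_eq_iff mult.assoc[symmetric])
  qed
  ultimately show ?thesis using meas distr by (simp add: gauss_isometry_def)
qed

text \<open>\<open>T\<close> straightens the flat \<open>L\<close>: it maps \<open>L\<close> onto a coordinate subspace. To adjoin the next
  hyperplane by a single plane reflection, one keeps track of the fact that every old coordinate is, on
  \<open>L\<close>, a multiple of one free coordinate of the image.\<close>

definition straightens where
  "straightens n j L k T Z \<longleftrightarrow> gauss_isometry n T \<and> Z \<subseteq> {..<j} \<and> card Z + k = j \<and>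
    L = {y. \<forall>q\<in>Z. T y q = 0} \<and> (\<forall>y. \<forall>q\<ge>j. T y q = y q) \<and>
    (\<forall>i<j. \<exists>\<alpha> p. (\<alpha> = 0 \<or> p < j \<and> p \<notin> Z) \<and> (\<forall>y\<in>L. y i = \<alpha> * T y p))"

lemma straightens_Suc:
  assumes "straightens n j L k T Z"
  shows "straightens n (Suc j) L (Suc k) T Z"
proof -
  have "\<exists>\<alpha> p. (\<alpha> = 0 \<or> p < Suc j \<and> p \<notin> Z) \<and> (\<forall>y\<in>L. y i = \<alpha> * T y p)" if "i < Suc j" for i
  proof (cases "i = j")
    case True
    \<comment> \<open>The new coordinate is still untouched by \<open>T\<close> and is free, so it
      is a multiple of itself.\<close>
    with assms show ?thesis
      by (intro exI[of _ 1] exI[of _ j]) (auto simp: straightens_def)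
  next
    case False
    with that have "i < j" by simp
    with assms obtain \<alpha> p where "\<alpha> = 0 \<or> p < j \<and> p \<notin> Z" "\<forall>y\<in>L. y i = \<alpha> * T y p"
      unfolding straightens_def by blast
    then show ?thesis by (intro exI[of _ \<alpha>] exI[of _ p]) auto
  qed
  then show ?thesis using assms unfolding straightens_def by auto
qed

text \<open>With \<open>z = T y\<close>, the new hyperplane reads
  \<open>z j = \<alpha> * z p\<close> on \<open>L\<close>, where \<open>p\<close> is a free
  coordinate unless \<open>\<alpha> = 0\<close>. In that case it is a coordinate hyperplane already;
  otherwise the reflection of the \<open>(p, j)\<close> plane whose row \<open>j\<close> is the unit
  normal \<open>(\<alpha>, -1) / sqrt (1 + \<alpha>^2)\<close> makes it one.\<close>

lemma straightens_cut:
  assumes str: "straightens n j L k T Z" and j: "j < n"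
    and f: "\<alpha> = 0 \<or> p < j \<and> p \<notin> Z" "\<And>y. y \<in> L \<Longrightarrow> f y = \<alpha> * T y p"
  shows "\<exists>T' Z'. straightens n (Suc j) (L \<inter> {y. y j = f y}) k T' Z'"
proof -
  let ?L = "L \<inter> {y. y j = f y}"
  have T: "gauss_isometry n T" "Z \<subseteq> {..<j}" "card Z + k = j" "L = {y. \<forall>q\<in>Z. T y q = 0}"
    "\<And>y q. j \<le> q \<Longrightarrow> T y q = y q"
    and coord: "\<And>i. i < j \<Longrightarrow> \<exists>\<alpha> p. (\<alpha> = 0 \<or> p < j \<and> p \<notin> Z) \<and> (\<forall>y\<in>L. y i = \<alpha> * T y p)"
    using str by (auto simp: straightens_def)
  have fin: "finite Z" "j \<notin> Z" using T(2) finite_subset by auto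
  then have Z': "insert j Z \<subseteq> {..<Suc j}" "card (insert j Z) + k = Suc j"
    using T(2,3) by auto
  show ?thesis
  proof (cases "\<alpha> = 0")
    case True
    have "?L = {y. \<forall>q\<in>insert j Z. T y q = 0}" using T(4,5) f(2) True by auto
    moreover have "\<exists>\<alpha> p. (\<alpha> = 0 \<or> p < Suc j \<and> p \<notin> insert j Z) \<and> (\<forall>y\<in>?L. y i = \<alpha> * T y p)"
      if "i < Suc j" for i
    proof (cases "i = j")
      case True
      then show ?thesis using f(2) \<open>\<alpha> = 0\<close> by (intro exI[of _ 0]) auto
    next
      case False
      with that have "i < j" by simp
      from coord[OF this] obtain \<beta> r where "\<beta> = 0 \<or> r < j \<and> r \<notin> Z" "\<forall>y\<in>L. y i = \<beta> * T y r" by blast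
      then show ?thesis by (intro exI[of _ \<beta>] exI[of _ r]) auto
    qed
    ultimately have "straightens n (Suc j) ?L k T (insert j Z)"
      unfolding straightens_def using T(1,5) Z' by auto
    then show ?thesis by blast
  next
    case False
    then have p: "p < j" "p \<notin> Z" using f(1) by auto
    define d where "d = sqrt (1 + \<alpha>\<^sup>2)"
    have d: "0 < d" "d\<^sup>2 = 1 + \<alpha>\<^sup>2" by (auto simp: d_def intro!: add_pos_nonneg)
    define c s where "c = 1 / d" and "s = \<alpha> / d"
    have cs: "c\<^sup>2 + s\<^sup>2 = 1" "s \<noteq> 0" "0 < c" "s = \<alpha> * c"
      using d False by (auto simp: c_def s_def power_divide add_divide_distrib[symmetric])
    define R where "R = plane_reflection p j c s"
    have R: "R z p = c * z p + s * z j" "R z j = s * z p - c * z j" "q \<noteq> p \<Longrightarrow> q \<noteq> j \<Longrightarrow> R z q = z q" for z q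
      using p by (auto simp: R_def plane_reflection_def)
    let ?T = "R \<circ> T"
    have iso: "gauss_isometry n ?T"
      unfolding R_def using p j cs by (intro gauss_isometry_comp gauss_isometry_plane_reflection T(1)) auto
    have off: "?T y q = T y q" if "q \<in> Z" for y q
      using that p fin(2) by (auto intro: R(3))
    have inv: "T y = R (?T y)" for y
      using plane_reflection_involution[of p j c s "T y"] p cs by (simp add: R_def)
    \<comment> \<open>On the cut flat the coordinate \<open>j\<close> of the new image is 0, so the
      old coordinates \<open>p\<close> and \<open>j\<close> both become multiples of the new
      coordinate \<open>p\<close>: the invariant survives with \<open>p\<close> still free.\<close>
    have T_coords: "T y p = c * ?T y p + s * ?T y j" "T y j = s * ?T y p - c * ?T y j" for y
      using fun_cong[OF inv[of y], of p] fun_cong[OF inv[of y], of j] unfolding R(1,2) .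
    have eqL: "?L = {y. \<forall>q\<in>insert j Z. ?T y q = 0}"
    proof (intro set_eqI)
      fix y
      have "?T y j = c * (\<alpha> * T y p - y j)"
        using R(2)[of "T y"] T(5)[of j y] cs(4) by (simp add: algebra_simps)
      then have "?T y j = 0 \<longleftrightarrow> y j = \<alpha> * T y p" using cs(3) by auto
      moreover have "y \<in> L \<longleftrightarrow> (\<forall>q\<in>Z. ?T y q = 0)" using T(4) off by auto
      ultimately show "y \<in> ?L \<longleftrightarrow> y \<in> {y. \<forall>q\<in>insert j Z. ?T y q = 0}" using f(2) by auto
    qed
    have coord': "\<exists>\<alpha> p. (\<alpha> = 0 \<or> p < Suc j \<and> p \<notin> insert j Z) \<and> (\<forall>y\<in>?L. y i = \<alpha> * ?T y p)"
      if "i < Suc j" for i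
    proof (cases "i = j")
      case True
      have "y j = s * ?T y p" if "y \<in> ?L" for y
        using that T_coords(2)[of y] T(5)[of j y] unfolding eqL by simp
      then show ?thesis using True p by (intro exI[of _ s] exI[of _ p]) auto
    next
      case False
      with that have "i < j" by simp
      from coord[OF this] obtain \<beta> r where r: "\<beta> = 0 \<or> r < j \<and> r \<notin> Z" "\<forall>y\<in>L. y i = \<beta> * T y r" by blast
      show ?thesis
      proof (cases "r = p")
        case True
        have "y i = (\<beta> * c) * ?T y p" if "y \<in> ?L" for y
        proof -
          have "?T y j = 0" using that unfolding eqL by simp
          moreover have "y i = \<beta> * T y p" using that r(2) True by simp
          ultimately show ?thesis using T_coords(1)[of y] by simp
        qed
        then show ?thesis using p by (intro exI[of _ "\<beta> * c"] exI[of _ p]) auto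
      next
        case False
        have "y i = \<beta> * ?T y r" if "y \<in> ?L" for y
        proof (cases "\<beta> = 0")
          case True
          then show ?thesis using that r(2) by auto
        next
          case False
          then have "?T y r = T y r" using r(1) \<open>r \<noteq> p\<close> by (auto intro: R(3))
          then show ?thesis using that r(2) by auto
        qed
        then show ?thesis using r(1) by (intro exI[of _ \<beta>] exI[of _ r]) auto
      qed
    qed
    have tail: "?T y q = y q" if "Suc j \<le> q" for y q
      using that p T(5)[of q y] by (simp add: R(3))
    have "straightens n (Suc j) ?L k ?T (insert j Z)"
      unfolding straightens_def by (intro conjI allI impI iso Z' eqL tail coord')
    then show ?thesis by (intro exI)
  qed
qed

text \<open>A hyperplane ties coordinate \<open>j\<close> to one earlier coordinate or to 0, and on
  the flat that coordinate is a multiple of a single free one; so each new equation has the two-term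
  form that one reflection can straighten. Geometrically, the coordinates fall into blocks of
  proportional ones.\<close>

lemma flats_straightens:
  assumes H: "\<And>j P. P \<in> set (H j) \<Longrightarrow> \<exists>s i. P = {y. y j = s * y i} \<and> (s = 0 \<or> i < j)"
    and "(L, k) \<in> set (flats H j)" "j \<le> n"
  shows "\<exists>T Z. straightens n j L k T Z"
  using assms(2,3)
proof (induction j arbitrary: L k)
  case 0
  have "straightens n 0 UNIV 0 id {}" by (simp add: straightens_def gauss_isometry_id)
  with 0 show ?case by auto
next
  case (Suc j)
  then obtain L' k' where L': "(L', k') \<in> set (flats H j)"
    and L: "L = L' \<and> k = Suc k' \<or> (\<exists>P\<in>set (H j). L = L' \<inter> P \<and> k = k')"
    by auto
  obtain T Z where str: "straightens n j L' k' T Z" using Suc.IH[OF L'] Suc.prems by auto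
  show ?case
  proof (cases "L = L' \<and> k = Suc k'")
    case True
    then show ?thesis using straightens_Suc[OF str] by auto
  next
    case False
    then obtain P where P: "P \<in> set (H j)" "L = L' \<inter> P" "k = k'" using L by auto
    obtain s i where si: "P = {y. y j = s * y i}" "s = 0 \<or> i < j" using H[OF P(1)] by auto
    show ?thesis
    proof (cases "s = 0")
      case True
      have "\<exists>T' Z'. straightens n (Suc j) (L' \<inter> {y. y j = s * y i}) k' T' Z'"
        by (rule straightens_cut[OF str, where \<alpha> = 0 and p = 0]) (use Suc.prems True in auto)
      then show ?thesis by (simp add: P si(1))
    next
      case False
      then have "i < j" using si by simp
      then obtain \<alpha> p where "\<alpha> = 0 \<or> p < j \<and> p \<notin> Z" "\<forall>y\<in>L'. y i = \<alpha> * T y p"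
        using str unfolding straightens_def by blast
      then have "\<exists>T' Z'. straightens n (Suc j) (L' \<inter> {y. y j = s * y i}) k' T' Z'"
        by (intro straightens_cut[OF str, where \<alpha> = "s * \<alpha>" and p = p]) (use Suc.prems in auto)
      then show ?thesis by (simp add: P si(1))
    qed
  qed
qed

lemma dist2_prob_straightens:
  assumes "straightens n n L k T Z" "1 \<le> n" "0 \<le> lam"
  shows "dist2_prob n L lam = beta_kn k n lam"
proof -
  have T: "gauss_isometry n T" "Z \<subseteq> {..<n}" "card Z + k = n" "L = {y. T y \<in> {z. \<forall>q\<in>Z. z q = 0}}"
    using assms(1) by (auto simp: straightens_def)
  have "dist2_prob n L lam = dist2_prob n {z. \<forall>q\<in>Z. z q = 0} lam"
    unfolding T(4) by (rule dist2_prob_isometry[OF T(1)]) auto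
  also have "\<dots> = beta_kn k n lam"
    using T(2,3) assms by (intro dist2_prob_coordinate_subspace) auto
  finally show ?thesis .
qed

lemma hyperplanes_A_form:
  assumes "P \<in> set (hyperplanes_A j)"
  shows "\<exists>s i. P = {y. y j = s * y i} \<and> (s = 0 \<or> i < j)"
proof -
  obtain i where "i < j" "P = {y. y j = y i}" using assms unfolding hyperplanes_A_def by auto
  then show ?thesis by (intro exI[of _ 1] exI[of _ i]) auto
qed

lemma hyperplanes_B_form:
  assumes "P \<in> set (hyperplanes_B j)"
  shows "\<exists>s i. P = {y. y j = s * y i} \<and> (s = 0 \<or> i < j)"
proof -
  consider "P = {y. y j = 0}" | i where "i < j" "P = {y. y j = y i}" | i where "i < j" "P = {y. y j = - y i}"
    using assms unfolding hyperplanes_B_def by auto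
  then show ?thesis
  proof cases
    case 1
    then show ?thesis by (intro exI[of _ 0]) auto
  next
    case 2
    then show ?thesis by (intro exI[of _ 1] exI[of _ i]) auto
  next
    case 3
    then show ?thesis by (intro exI[of _ "-1"] exI[of _ i]) auto
  qed
qed

section \<open>Uniqueness of the intrinsic volumes\<close>

text \<open>The density may be unbounded at 0 and 1, so the fundamental theorem of calculus is
  applied on a compact \<open>[l, r]\<close> inside; the integral from 0 to \<open>l\<close> is a
  constant.\<close>

lemma beta_cdf_has_derivative:
  assumes pq: "0 < p" "0 < q" and x: "0 < x" "x < 1"
  shows "(beta_cdf p q has_real_derivative x powr (p - 1) * (1 - x) powr (q - 1) / Beta p q) (at x)"
proof -
  let ?f = "\<lambda>t::real. t powr (p - 1) * (1 - t) powr (q - 1)"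
  define l r where "l = x / 2" and "r = (x + 1) / 2"
  have lr: "0 < l" "l < x" "x < r" "r < 1" using x by (auto simp: l_def r_def)
  have int: "set_integrable lborel {0<..<1} ?f"
    unfolding set_integrable_def
  proof (rule integrableI_nonneg)
    have "(\<integral>\<^sup>+t. ennreal (indicator {0<..<1} t *\<^sub>R ?f t) \<partial>lborel) = (\<integral>\<^sup>+t. beta_kernel p q t \<partial>lborel)"
      by (intro nn_integral_cong) (auto simp: beta_kernel_def split: split_indicator)
    then show "(\<integral>\<^sup>+t. ennreal (indicator {0<..<1} t *\<^sub>R ?f t) \<partial>lborel) < \<infinity>"
      by (simp add: nn_integral_beta_kernel[OF pq])
  qed auto
  have split: "beta_cdf p q u = ((LBINT t=0..ereal l. ?f t) + (LBINT t=ereal l..ereal u. ?f t)) / Beta p q"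
    if u: "l \<le> u" "u \<le> r" for u
  proof -
    have "(LBINT t=0..ereal l. ?f t) + (LBINT t=ereal l..ereal u. ?f t) = (LBINT t=0..ereal u. ?f t)"
    proof (rule interval_integral_sum)
      have "min 0 (min (ereal l) (ereal u)) = ereal 0" "max 0 (max (ereal l) (ereal u)) = ereal u"
        using u lr by (auto simp: min_def max_def zero_ereal_def)
      moreover have "set_integrable lborel {0<..<u} ?f"
        by (rule set_integrable_subset[OF int]) (use u lr in auto)
      moreover have "einterval 0 (ereal u) = {0<..<u}"
        using einterval_eq_Icc[of 0 u] by (simp add: zero_ereal_def)
      ultimately show "interval_lebesgue_integrable lborel (min 0 (min (ereal l) (ereal u)))
          (max 0 (max (ereal l) (ereal u))) ?f"
        using u lr by (simp add: interval_lebesgue_integrable_def)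
    qed
    moreover have "min u 1 = u" using u lr by simp
    ultimately show ?thesis using pq u lr by (simp add: beta_cdf_def)
  qed
  have cont: "continuous_on {l..r} ?f"
    using lr by (intro continuous_intros) auto
  have "((\<lambda>u. LBINT t=ereal l..ereal u. ?f t) has_vector_derivative ?f x) (at x within {l..r})"
    by (rule interval_integral_FTC2[OF _ _ cont]) (use lr in auto)
  moreover have "at x within {l..r} = at x"
    using lr by (intro at_within_interior) (auto simp: interior_atLeastAtMost_real)
  ultimately have "((\<lambda>u. LBINT t=ereal l..ereal u. ?f t) has_real_derivative ?f x) (at x)"
    by (simp add: has_real_derivative_iff_has_vector_derivative)
  then have "((\<lambda>u. ((LBINT t=0..ereal l. ?f t) + (LBINT t=ereal l..ereal u. ?f t)) / Beta p q)
      has_real_derivative ?f x / Beta p q) (at x)"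
    using Beta_real_pos[OF pq] by (auto intro!: derivative_eq_intros)
  note deriv = this
  have "eventually (\<lambda>u. u \<in> {l<..<r}) (nhds x)"
    using lr by (intro eventually_nhds_in_open) auto
  then have "eventually (\<lambda>u. ((LBINT t=0..ereal l. ?f t) + (LBINT t=ereal l..ereal u. ?f t)) / Beta p q = beta_cdf p q u) (nhds x)"
    by eventually_elim (use split in auto)
  from DERIV_cong_ev[OF refl this refl] deriv show ?thesis by simp
qed

text \<open>This substitution reduces the linear independence of the beta laws to that of monomials.\<close>

lemma beta_density_monomial:
  fixes r :: real
  assumes r: "0 < r"
  defines "x \<equiv> 1 / (1 + r\<^sup>2)"
  shows "x powr ((real n - real k) / 2 - 1) * (1 - x) powr (real k / 2 - 1) =
    (x powr (real n / 2 - 1) / (1 - x)) * r ^ k"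
proof -
  have "0 < 1 + r\<^sup>2" by (simp add: add_pos_nonneg)
  then have x: "0 < x" "x < 1" "1 - x = x * r\<^sup>2"
    using r by (auto simp: x_def field_simps)
  have "(1 - x) powr (real k / 2 - 1) = (1 - x) powr (real k / 2) / (1 - x)"
    using x(1,2) by (simp add: powr_diff)
  also have "(1 - x) powr (real k / 2) = x powr (real k / 2) * r ^ k"
  proof -
    have "(r\<^sup>2) powr (real k / 2) = r ^ k"
      using r by (simp add: powr_powr powr_realpow flip: powr_numeral)
    then show ?thesis unfolding x(3) using x(1) by (simp add: powr_mult)
  qed
  finally have "x powr ((real n - real k) / 2 - 1) * (1 - x) powr (real k / 2 - 1) =
      (x powr ((real n - real k) / 2 - 1) * x powr (real k / 2)) * (r ^ k / (1 - x))"
    by simp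
  also have "x powr ((real n - real k) / 2 - 1) * x powr (real k / 2) = x powr (real n / 2 - 1)"
    by (simp add: powr_add[symmetric] diff_divide_distrib)
  finally show ?thesis by simp
qed

text \<open>The laws for \<open>k = n\<close> and \<open>k = 0\<close> are point masses at 0 and 1,
  invisible to the derivative on \<open>(0, 1)\<close>. The other densities become, up to a common
  factor, powers of \<open>r = sqrt ((1 - x) / x)\<close>, and a polynomial vanishing for all
  positive \<open>r\<close> has zero coefficients. Evaluation at 0 and 1 then removes the two
  atoms.\<close>

lemma beta_kn_independent:
  assumes n: "1 \<le> n" and zero: "\<And>lam. 0 \<le> lam \<Longrightarrow> (\<Sum>k\<le>n. beta_kn k n lam * c k) = 0"
    and k: "k \<le> n"
  shows "c k = 0"
proof -
  have inner: "c k = 0" if k: "0 < k" "k < n" for k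
  proof (rule ccontr)
    assume ck: "c k \<noteq> 0"
    define d where "d i = (if 0 < i \<and> i < n then c i / Beta ((real n - real i) / 2) (real i / 2) else 0)" for i
    have deriv: "((\<lambda>lam. beta_kn i n lam * c i) has_real_derivative
        x powr ((real n - real i) / 2 - 1) * (1 - x) powr (real i / 2 - 1) * d i) (at x)"
      if x: "0 < x" "x < 1" and i: "i \<le> n" for x i
    proof (cases "0 < i \<and> i < n")
      case True
      then have "(beta_kn i n has_real_derivative x powr ((real n - real i) / 2 - 1) * (1 - x) powr (real i / 2 - 1)
          / Beta ((real n - real i) / 2) (real i / 2)) (at x)"
        using beta_cdf_has_derivative[of "(real n - real i) / 2" "real i / 2" x] x
        by (simp add: beta_kn_def[abs_def])
      from DERIV_cmult_right[OF this, of "c i"] show ?thesis using True by (simp add: d_def)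
    next
      case False
      have "eventually (\<lambda>lam. lam \<in> {0<..<1}) (nhds x)"
        using x by (intro eventually_nhds_in_open) auto
      then have "eventually (\<lambda>lam. beta_kn i n lam * c i = (if i = n then c i else 0)) (nhds x)"
        by (rule eventually_mono) (use False i n in \<open>auto simp: beta_kn_def beta_cdf_def\<close>)
      then have "((\<lambda>lam. beta_kn i n lam * c i) has_real_derivative 0) (at x)"
        by (subst DERIV_cong_ev[OF refl _ refl]) auto
      moreover have "d i = 0" using False by (auto simp: d_def)
      ultimately show ?thesis by simp
    qed
    have "(\<Sum>i\<le>n. x powr ((real n - real i) / 2 - 1) * (1 - x) powr (real i / 2 - 1) * d i) = 0"
      if x: "0 < x" "x < 1" for x
    proof (rule DERIV_unique)
      show "((\<lambda>lam. \<Sum>i\<le>n. beta_kn i n lam * c i) has_real_derivative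
          (\<Sum>i\<le>n. x powr ((real n - real i) / 2 - 1) * (1 - x) powr (real i / 2 - 1) * d i)) (at x)"
        using deriv[OF x] by (intro DERIV_sum) auto
      have "eventually (\<lambda>lam. lam \<in> {0<..<1}) (nhds x)"
        using x by (intro eventually_nhds_in_open) auto
      then have "eventually (\<lambda>lam. (\<Sum>i\<le>n. beta_kn i n lam * c i) = 0) (nhds x)"
        by eventually_elim (simp add: zero)
      then show "((\<lambda>lam. \<Sum>i\<le>n. beta_kn i n lam * c i) has_real_derivative 0) (at x)"
        by (subst DERIV_cong_ev[OF refl _ refl]) auto
    qed
    then have root: "(\<Sum>i\<le>n. d i * r ^ i) = 0" if r: "0 < r" for r :: real
    proof -
      define x where "x = 1 / (1 + r\<^sup>2)"
      have x: "0 < x" "x < 1" using r by (auto simp: x_def field_simps add_pos_nonneg)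
      have "0 = (\<Sum>i\<le>n. x powr ((real n - real i) / 2 - 1) * (1 - x) powr (real i / 2 - 1) * d i)"
        using \<open>\<And>x. 0 < x \<Longrightarrow> x < 1 \<Longrightarrow> _ x = 0\<close> x by simp
      also have "\<dots> = (\<Sum>i\<le>n. (x powr (real n / 2 - 1) / (1 - x)) * (d i * r ^ i))"
        unfolding x_def beta_density_monomial[OF r] by (simp add: mult_ac)
      also have "\<dots> = (x powr (real n / 2 - 1) / (1 - x)) * (\<Sum>i\<le>n. d i * r ^ i)"
        by (simp add: sum_distrib_left)
      finally show ?thesis using x by simp
    qed
    have "d k \<noteq> 0" using ck k Beta_real_pos[of "(real n - real k) / 2" "real k / 2"] by (simp add: d_def)
    then have "finite {r. (\<Sum>i\<le>n. d i * r ^ i) = 0}"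
      unfolding polyfun_finite_roots using k by (intro exI[of _ k]) auto
    then have "finite {0 :: real<..}" by (rule rev_finite_subset) (auto simp: root)
    then show False by (simp add: infinite_Ioi)
  qed
  have "(\<Sum>k\<le>n. beta_kn k n 0 * c k) = (\<Sum>k\<le>n. if k = n then c k else 0)"
    using n by (intro sum.cong) (auto simp: beta_kn_def beta_cdf_def)
  then have cn: "c n = 0" using zero[of 0] by simp
  have "(\<Sum>k\<le>n. beta_kn k n 1 * c k) = (\<Sum>k\<le>n. if k = 0 then c k else 0)"
    using n cn inner by (intro sum.cong) (auto simp: beta_kn_def beta_cdf_def le_less)
  then have "c 0 = 0" using zero[of 1] by simp
  with cn inner k show ?thesis by (cases "k = 0"; cases "k = n") auto
qed

section \<open>Homogeneity, and the passage from open chambers to closed cones\<close>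

lemma dist2_restrict: "dist2 n C (restrict x {..<n}) = dist2 n C x"
  by (simp add: dist2_def)

text \<open>One inequality for every positive factor is enough: it is used for \<open>c\<close> and
  for \<open>1 / c\<close>.\<close>

lemma dist2_scale:
  assumes cone: "\<And>y c. y \<in> C \<Longrightarrow> 0 < c \<Longrightarrow> (\<lambda>i. c * y i) \<in> C" and ne: "C \<noteq> {}" and c: "0 < c"
  shows "dist2 n C (\<lambda>i. c * x i) = c\<^sup>2 * dist2 n C x"
proof -
  have le: "dist2 n C (\<lambda>i. c * x i) \<le> c\<^sup>2 * dist2 n C x" if "0 < c" for c x
  proof -
    have "dist2 n C (\<lambda>i. c * x i) / c\<^sup>2 \<le> dist2 n C x"
    proof (rule dist2_greatest[OF ne])
      fix y assume "y \<in> C"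
      from dist2_lower[OF cone[OF this that]]
      have "dist2 n C (\<lambda>i. c * x i) \<le> (\<Sum>i<n. (c * x i - c * y i)\<^sup>2)" .
      also have "\<dots> = c\<^sup>2 * (\<Sum>i<n. (x i - y i)\<^sup>2)"
        by (simp add: sum_distrib_left power_mult_distrib flip: right_diff_distrib)
      finally show "dist2 n C (\<lambda>i. c * x i) / c\<^sup>2 \<le> (\<Sum>i<n. (x i - y i)\<^sup>2)"
        using that by (simp add: field_simps)
    qed
    then show ?thesis using that by (simp add: field_simps)
  qed
  have "dist2 n C x \<le> (1 / c)\<^sup>2 * dist2 n C (\<lambda>i. c * x i)"
    using le[of "1 / c" "\<lambda>i. c * x i"] c by simp
  with le[OF c, of x] c show ?thesis by (simp add: field_simps)
qed

text \<open>The open chamber \<open>A\<close> consists of extensional functions, the cone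
  \<open>C\<close> of arbitrary ones. A small push along \<open>v\<close> followed by restriction
  leads from \<open>C\<close> into \<open>A\<close>, so both have the same distances;
  \<open>v\<close> may depend on the point, as is done for type D.\<close>

lemma dist_cdf_eq_dist2_prob:
  assumes A: "A \<noteq> {}" "A \<subseteq> C"
    and perturb: "\<And>y e. y \<in> C \<Longrightarrow> 0 < e \<Longrightarrow> restrict (\<lambda>i. y i + e * v y i) {..<n} \<in> A"
    and cone: "\<And>y c. y \<in> C \<Longrightarrow> 0 < c \<Longrightarrow> (\<lambda>i. c * y i) \<in> C"
  shows "dist_cdf n A lam = dist2_prob n C lam"
proof -
  have ne: "C \<noteq> {}" using A by auto
  have dist: "dist2_closure n A x = dist2 n C x" for x
  proof -
    have "dist2_closure n A x = dist2 n (closure A) x"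
      by (simp add: dist2_closure_def dist2_def eucl_dist_sq)
    also have "\<dots> = dist2 n A x"
      using A(1) closure_subset by (intro dist2_cong_closure) auto
    also have "\<dots> = dist2 n C x"
    proof (rule antisym)
      show "dist2 n C x \<le> dist2 n A x" using A by (intro dist2_antimono)
      show "dist2 n A x \<le> dist2 n C x"
      proof (rule dist2_greatest[OF ne])
        fix y assume y: "y \<in> C"
        have "((\<lambda>e. \<Sum>i<n. (x i - (y i + e * v y i))\<^sup>2) \<longlongrightarrow> (\<Sum>i<n. (x i - (y i + 0 * v y i))\<^sup>2)) (at_right 0)"
          by (intro tendsto_intros)
        moreover have "eventually (\<lambda>e. dist2 n A x \<le> (\<Sum>i<n. (x i - (y i + e * v y i))\<^sup>2)) (at_right 0)"
          using eventually_at_right_less[of "0::real"]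
        proof eventually_elim
          case (elim e)
          from dist2_lower[OF perturb[OF y elim], of n x] show ?case by simp
        qed
        ultimately have "dist2 n A x \<le> (\<Sum>i<n. (x i - (y i + 0 * v y i))\<^sup>2)"
          by (rule tendsto_lowerbound) simp
        then show "dist2 n A x \<le> (\<Sum>i<n. (x i - y i)\<^sup>2)" by simp
      qed
    qed
    finally show ?thesis .
  qed
  have "(eucl_norm n g \<noteq> 0 \<and> dist2_closure n A (sphere_normalize n g) \<le> lam) =
      ((\<Sum>i<n. (g i)\<^sup>2) \<noteq> 0 \<and> dist2 n C g \<le> lam * (\<Sum>i<n. (g i)\<^sup>2))" for g
  proof (cases "eucl_norm n g = 0")
    case True
    then show ?thesis using eucl_norm_sq[of n g] by simp
  next
    case False
    moreover have "0 \<le> eucl_norm n g" by (simp add: eucl_norm_def sum_nonneg)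
    ultimately have N: "0 < eucl_norm n g" by simp
    have "dist2_closure n A (sphere_normalize n g) = dist2 n C (\<lambda>i. (1 / eucl_norm n g) * g i)"
      by (simp add: dist sphere_normalize_def dist2_restrict)
    also have "\<dots> = (1 / eucl_norm n g)\<^sup>2 * dist2 n C g"
      by (rule dist2_scale[OF cone ne]) (use N in auto)
    also have "\<dots> = dist2 n C g / (\<Sum>i<n. (g i)\<^sup>2)"
      by (simp add: power_divide eucl_norm_sq)
    finally show ?thesis
      using N zero_less_power[OF N, of 2] by (simp add: eucl_norm_sq pos_divide_le_eq)
  qed
  then show ?thesis by (simp add: dist_cdf_def dist2_prob_def)
qed

lemma conic_intrinsic_volume_eqI:
  assumes n: "1 \<le> n" and k: "k \<le> n"
    and eq: "\<And>lam. 0 \<le> lam \<Longrightarrow> dist_cdf n C lam = (\<Sum>k\<le>n. v k * beta_kn k n lam)"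
  shows "conic_intrinsic_volume n C k = v k"
proof -
  let ?v = "\<lambda>k. if k \<le> n then v k else 0"
  have "conic_intrinsic_volume n C = ?v"
    unfolding conic_intrinsic_volume_def
  proof (rule the_equality)
    show "(\<forall>k>n. ?v k = 0) \<and> (\<forall>lam\<ge>0. dist_cdf n C lam = (\<Sum>k\<le>n. beta_kn k n lam * ?v k))"
      by (auto simp: eq mult.commute intro!: sum.cong)
  next
    fix w assume w: "(\<forall>k>n. w k = 0) \<and> (\<forall>lam\<ge>0. dist_cdf n C lam = (\<Sum>k\<le>n. beta_kn k n lam * w k))"
    have "(\<Sum>k\<le>n. beta_kn k n lam * (w k - v k)) = 0" if "0 \<le> lam" for lam
      using w that eq[OF that] by (simp add: right_diff_distrib sum_subtractf mult.commute)
    then have "w k - v k = 0" if "k \<le> n" for k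
      using beta_kn_independent[OF n, of "\<lambda>k. w k - v k" k] that by auto
    then show "w = ?v" using w by (auto simp: fun_eq_iff)
  qed
  then show ?thesis using k by simp
qed

section \<open>Weyl chambers\<close>

lemma sum_flats_beta_kn:
  "(\<Sum>(L, k)\<leftarrow>flats H j. beta_kn k n lam) =
    (\<Sum>k\<le>j. real (coeff (\<Prod>i<j. [:length (H i), 1:]) k) * beta_kn k n lam)"
  by (rule sum_list_flats)

lemma flats_nonempty:
  assumes "\<And>j P. P \<in> set (H j) \<Longrightarrow> \<exists>s i. P = {y. y j = s * y i} \<and> (s = 0 \<or> i < j)"
    and "(L, k) \<in> set (flats H j)"
  shows "(\<lambda>_. 0) \<in> L"
  using assms(2)
proof (induction j arbitrary: L k)
  case (Suc j)
  then obtain L' k' where "(L', k') \<in> set (flats H j)" "L = L' \<or> (\<exists>P\<in>set (H j). L = L' \<inter> P)" by auto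
  moreover from this have "(\<lambda>_. 0) \<in> L'" using Suc.IH by blast
  ultimately show ?case using assms(1) by fastforce
qed simp

lemma positive_chain_cone_zero: "(\<lambda>_. 0) \<in> positive_chain_cone zs"
  using pointed_convex_chain_cone[of zs]
  by (simp add: positive_chain_cone_def form_val_def pointed_convex_def)

lemma chain_cone_zero: "(\<lambda>_. 0) \<in> chain_cone zs"
  using pointed_convex_chain_cone[of zs] by (simp add: pointed_convex_def)

abbreviation "coords n \<equiv> map (Pair (1 :: real)) [0..<n]"

lemma chain_cone_signed_coords:
  assumes "signed_permutation n zs"
  shows "chain_cone zs = {y. signed_coords zs y \<in> chain_cone (coords n)}"
  using map_form_val_signed_coords[OF signed_permutation_length[OF assms]]
  by (simp add: chain_cone_def del: map_map)

lemma positive_chain_cone_signed_coords: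
  assumes "signed_permutation n zs"
  shows "positive_chain_cone zs = {y. signed_coords zs y \<in> positive_chain_cone (coords n)}"
proof -
  have "positive_chain_cone zs = {y. (\<forall>v\<in>set (map (form_val y) zs). 0 \<le> v) \<and> sorted (map (form_val y) zs)}" for zs
    by (auto simp: positive_chain_cone_def chain_cone_def)
  then show ?thesis
    by (simp only: map_form_val_signed_coords[OF signed_permutation_length[OF assms]] mem_Collect_eq)
qed

lemma dist2_prob_positive_chain_cone:
  assumes "signed_permutation n zs"
  shows "dist2_prob n (positive_chain_cone zs) lam = dist2_prob n (positive_chain_cone (coords n)) lam"
  unfolding positive_chain_cone_signed_coords[OF assms]
  by (rule dist2_prob_isometry[OF gauss_isometry_signed_coords[OF assms]])
    (use positive_chain_cone_zero in auto)

lemma dist2_prob_chamber_A: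
  assumes n: "1 \<le> n" and lam: "0 \<le> lam"
  shows "fact n * dist2_prob n (chain_cone (coords n)) lam = (\<Sum>k\<le>n. real (stirling n k) * beta_kn k n lam)"
proof -
  have "(\<Sum>C\<leftarrow>map chain_cone (chains_A n). dist2_prob n C lam) =
      (\<Sum>C\<leftarrow>map fst (flats hyperplanes_A n). dist2_prob n C lam)"
  proof (rule sum_list_dist2_prob)
    show "C \<noteq> {}" if "C \<in> set (map chain_cone (chains_A n))" for C
      using that chain_cone_zero by auto
    show "C \<noteq> {}" if "C \<in> set (map fst (flats hyperplanes_A n))" for C
      using that flats_nonempty[OF hyperplanes_A_form] by fastforce
    show "(\<Sum>C\<leftarrow>map chain_cone (chains_A n). f (dist2 n C x)) =
        (\<Sum>C\<leftarrow>map fst (flats hyperplanes_A n). f (dist2 n C x))" for f :: "real \<Rightarrow> real" and x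
      using dist2_chambers_A[of UNIV f n x n] by (simp add: o_def case_prod_unfold)
  qed
  also have "(\<Sum>C\<leftarrow>map fst (flats hyperplanes_A n). dist2_prob n C lam) = (\<Sum>(L, k)\<leftarrow>flats hyperplanes_A n. beta_kn k n lam)"
    unfolding map_map o_def case_prod_unfold
  proof (intro arg_cong[where f = sum_list] map_cong refl)
    fix p assume "p \<in> set (flats hyperplanes_A n)"
    then obtain T Z where "straightens n n (fst p) (snd p) T Z"
      using flats_straightens[of hyperplanes_A "fst p" "snd p" n n, OF hyperplanes_A_form] by auto
    then show "dist2_prob n (fst p) lam = beta_kn (snd p) n lam"
      by (rule dist2_prob_straightens[OF _ n lam])
  qed
  also have "(\<Sum>C\<leftarrow>map chain_cone (chains_A n). dist2_prob n C lam) =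
      (\<Sum>zs\<leftarrow>chains_A n. dist2_prob n (chain_cone (coords n)) lam)"
    unfolding map_map o_def
  proof (intro arg_cong[where f = sum_list] map_cong refl)
    fix zs assume "zs \<in> set (chains_A n)"
    then have zs: "signed_permutation n zs"
      using chains_A_indices[of zs n] by (simp add: signed_permutation_def)
    show "dist2_prob n (chain_cone zs) lam = dist2_prob n (chain_cone (coords n)) lam"
      unfolding chain_cone_signed_coords[OF zs]
      by (rule dist2_prob_isometry[OF gauss_isometry_signed_coords[OF zs]]) (use chain_cone_zero in auto)
  qed
  finally show ?thesis
    by (simp add: sum_list_triv length_chains_A sum_flats_beta_kn coeff_hyperplanes_A del: One_nat_def)
qed

lemma dist2_prob_chamber_B:
  assumes n: "1 \<le> n" and lam: "0 \<le> lam"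
  shows "2 ^ n * fact n * dist2_prob n (positive_chain_cone (coords n)) lam =
    (\<Sum>k\<le>n. real (B_num n k) * beta_kn k n lam)"
proof -
  have "(\<Sum>C\<leftarrow>map positive_chain_cone (chains_B n). dist2_prob n C lam) =
      (\<Sum>C\<leftarrow>map fst (flats hyperplanes_B n). dist2_prob n C lam)"
  proof (rule sum_list_dist2_prob)
    show "C \<noteq> {}" if "C \<in> set (map positive_chain_cone (chains_B n))" for C
      using that positive_chain_cone_zero by auto
    show "C \<noteq> {}" if "C \<in> set (map fst (flats hyperplanes_B n))" for C
      using that flats_nonempty[OF hyperplanes_B_form] by fastforce
    show "(\<Sum>C\<leftarrow>map positive_chain_cone (chains_B n). f (dist2 n C x)) =
        (\<Sum>C\<leftarrow>map fst (flats hyperplanes_B n). f (dist2 n C x))" for f :: "real \<Rightarrow> real" and x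
      using dist2_chambers_B[of UNIV f n x n] by (simp add: o_def case_prod_unfold)
  qed
  also have "(\<Sum>C\<leftarrow>map fst (flats hyperplanes_B n). dist2_prob n C lam) = (\<Sum>(L, k)\<leftarrow>flats hyperplanes_B n. beta_kn k n lam)"
    unfolding map_map o_def case_prod_unfold
  proof (intro arg_cong[where f = sum_list] map_cong refl)
    fix p assume "p \<in> set (flats hyperplanes_B n)"
    then obtain T Z where "straightens n n (fst p) (snd p) T Z"
      using flats_straightens[of hyperplanes_B "fst p" "snd p" n n, OF hyperplanes_B_form] by auto
    then show "dist2_prob n (fst p) lam = beta_kn (snd p) n lam"
      by (rule dist2_prob_straightens[OF _ n lam])
  qed
  also have "(\<Sum>C\<leftarrow>map positive_chain_cone (chains_B n). dist2_prob n C lam) =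
      (\<Sum>zs\<leftarrow>chains_B n. dist2_prob n (positive_chain_cone (coords n)) lam)"
    unfolding map_map o_def
  proof (intro arg_cong[where f = sum_list] map_cong refl)
    fix zs assume "zs \<in> set (chains_B n)"
    then show "dist2_prob n (positive_chain_cone zs) lam = dist2_prob n (positive_chain_cone (coords n)) lam"
      using chains_B_indices[of zs n] by (intro dist2_prob_positive_chain_cone) (simp add: signed_permutation_def)
  qed
  finally show ?thesis
    by (simp add: sum_list_triv length_chains_B sum_flats_beta_kn coeff_hyperplanes_B del: One_nat_def)
qed

definition wall_cone :: "nat \<Rightarrow> (nat \<Rightarrow> real) set" where
  "wall_cone n = {y. y 0 = 0} \<inter> positive_chain_cone (map (Pair 1) [1..<n])"

text \<open>The chambers of the first \<open>m = n - 1\<close> coordinates are summed inside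
  \<open>V = {y. y m = 0}\<close>, and a signed permutation moves the vanishing coordinate to the
  front. A flat of dimension \<open>k\<close> in the first \<open>m\<close> coordinates keeps this
  dimension when cut by \<open>V\<close> in \<open>n\<close> coordinates, so the weights are
  \<open>beta_kn k n\<close> with \<open>n\<close>, not \<open>n - 1\<close>.\<close>

lemma dist2_prob_wall:
  assumes n: "2 \<le> n" and lam: "0 \<le> lam"
  shows "2 ^ (n - 1) * fact (n - 1) * dist2_prob n (wall_cone n) lam =
    (\<Sum>k\<le>n - 1. real (B_num (n - 1) k) * beta_kn k n lam)"
proof -
  define m where "m = n - 1"
  have nm: "n = Suc m" "1 \<le> m" using n by (auto simp: m_def)
  let ?V = "{y :: nat \<Rightarrow> real. y m = 0}"
  have V: "pointed_convex ?V" by (rule pointed_convex_hyperplane) auto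
  have "(\<Sum>C\<leftarrow>map (\<lambda>zs. ?V \<inter> positive_chain_cone zs) (chains_B m). dist2_prob n C lam) =
      (\<Sum>C\<leftarrow>map (\<lambda>p. ?V \<inter> fst p) (flats hyperplanes_B m). dist2_prob n C lam)"
  proof (rule sum_list_dist2_prob)
    show "C \<noteq> {}" if "C \<in> set (map (\<lambda>zs. ?V \<inter> positive_chain_cone zs) (chains_B m))" for C
      using that positive_chain_cone_zero by fastforce
    show "C \<noteq> {}" if "C \<in> set (map (\<lambda>p. ?V \<inter> fst p) (flats hyperplanes_B m))" for C
      using that flats_nonempty[OF hyperplanes_B_form] by fastforce
    show "(\<Sum>C\<leftarrow>map (\<lambda>zs. ?V \<inter> positive_chain_cone zs) (chains_B m). f (dist2 n C x)) =
        (\<Sum>C\<leftarrow>map (\<lambda>p. ?V \<inter> fst p) (flats hyperplanes_B m). f (dist2 n C x))" for f :: "real \<Rightarrow> real" and x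
      using dist2_chambers_B[OF V, of f n x m] by (simp add: o_def case_prod_unfold)
  qed
  also have "(\<Sum>C\<leftarrow>map (\<lambda>p. ?V \<inter> fst p) (flats hyperplanes_B m). dist2_prob n C lam) =
      (\<Sum>(L, k)\<leftarrow>flats hyperplanes_B m. beta_kn k n lam)"
    unfolding map_map o_def case_prod_unfold
  proof (intro arg_cong[where f = sum_list] map_cong refl)
    fix p assume "p \<in> set (flats hyperplanes_B m)"
    then obtain T Z where "straightens n m (fst p) (snd p) T Z"
      using flats_straightens[of hyperplanes_B "fst p" "snd p" m n, OF hyperplanes_B_form] nm by auto
    then have "\<exists>T Z. straightens n n (fst p \<inter> {y. y m = 0}) (snd p) T Z"
      using straightens_cut[of n m "fst p" "snd p" T Z 0 0 "\<lambda>_. 0"] nm by auto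
    then show "dist2_prob n (?V \<inter> fst p) lam = beta_kn (snd p) n lam"
      using dist2_prob_straightens lam nm by (metis Int_commute le_add1 plus_1_eq_Suc)
  qed
  also have "(\<Sum>C\<leftarrow>map (\<lambda>zs. ?V \<inter> positive_chain_cone zs) (chains_B m). dist2_prob n C lam) =
      (\<Sum>zs\<leftarrow>chains_B m. dist2_prob n (wall_cone n) lam)"
    unfolding map_map o_def
  proof (intro arg_cong[where f = sum_list] map_cong refl)
    fix zs assume "zs \<in> set (chains_B m)"
    then have zs: "mset (map snd zs) = mset [0..<m]" "fst ` set zs \<subseteq> {1, -1}"
      using chains_B_indices[of zs m] by auto
    \<comment> \<open>Prepending \<open>m\<close> completes the chain to a signed permutation of all
      \<open>n\<close> coordinates and puts \<open>y m\<close> at position 0.\<close>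
    let ?zs = "(1, m) # zs"
    have perm: "signed_permutation n ?zs" using zs by (simp add: signed_permutation_def nm)
    have "?V \<inter> positive_chain_cone zs = {y. signed_coords ?zs y \<in> wall_cone n}"
    proof -
      have cone: "positive_chain_cone zs = {y. (\<forall>v\<in>set (map (form_val y) zs). 0 \<le> v) \<and> sorted (map (form_val y) zs)}" for zs
        by (auto simp: positive_chain_cone_def chain_cone_def)
      have tail: "map (form_val (signed_coords ?zs y)) (map (Pair 1) [1..<n]) = map (form_val y) zs" for y
        using map_form_val_signed_coords[OF signed_permutation_length[OF perm], of y]
        by (simp add: nm upt_conv_Cons del: upt_Suc)
      have head: "signed_coords ?zs y 0 = y m" for y
        by (simp add: signed_coords_def form_val_def)
      show ?thesis
        unfolding wall_cone_def cone by (simp only: set_eq_iff Int_iff mem_Collect_eq tail head) simp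
    qed
    then show "dist2_prob n (?V \<inter> positive_chain_cone zs) lam = dist2_prob n (wall_cone n) lam"
      using dist2_prob_isometry[OF gauss_isometry_signed_coords[OF perm], of "wall_cone n" lam]
        positive_chain_cone_zero by (fastforce simp: wall_cone_def)
  qed
  finally show ?thesis
    by (simp add: sum_list_triv length_chains_B sum_flats_beta_kn coeff_hyperplanes_B flip: m_def del: One_nat_def)
qed

definition chamber_D :: "nat \<Rightarrow> (nat \<Rightarrow> real) set" where
  "chamber_D n = {y. \<bar>y 0\<bar> \<le> y 1} \<inter> chain_cone (map (Pair 1) [1..<n])"

text \<open>The cut by \<open>y 0 = 0\<close> gives the probability as twice that of type B minus
  that of the wall. Multiplication by \<open>2^(n-1) * n!\<close> turns this into
  \<open>B(n,k) - n * B(n-1,k)\<close>, since the wall has weight \<open>2^(n-1) * (n-1)!\<close>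
  and leaves a factor \<open>n\<close>.\<close>

lemma dist2_prob_chamber_D:
  assumes n: "2 \<le> n" and lam: "0 \<le> lam"
  shows "2 ^ (n - 1) * fact n * dist2_prob n (chamber_D n) lam =
    (\<Sum>k\<le>n. real (D_num n k) * beta_kn k n lam)"
proof -
  let ?D = "chamber_D n"
  have upt: "[0..<n] = 0 # [1..<n]" "[1..<n] = 1 # [2..<n]"
    using n by (simp_all add: upt_conv_Cons numeral_2_eq_2)
  let ?S = "\<lambda>y :: nat \<Rightarrow> real. sorted (map y [1..<n])"
  have chain: "chain_cone (map (Pair 1) [1..<n]) = {y. ?S y}"
    by (simp add: chain_cone_def form_val_def o_def)
  \<comment> \<open>Along a sorted chain, lower bounds need only be checked at the first entry; this
    reconciles the condition on \<open>y 1\<close> with the conditions on all coordinates.\<close>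
  have least: "(\<forall>i\<in>{1..<n}. a \<le> y i) = (a \<le> y 1)" if "?S y" for y and a :: real
  proof -
    have "\<forall>i\<in>set [2..<n]. y 1 \<le> y i" using that unfolding upt(2) by simp
    moreover have "{1..<n} = insert 1 {2..<n}" using n by auto
    ultimately show ?thesis by auto
  qed
  have D: "pointed_convex ?D"
  proof -
    have "?D = {y. y 0 \<le> y 1} \<inter> {y. - y 0 \<le> y 1} \<inter> chain_cone (map (Pair 1) [1..<n])"
      by (auto simp: chamber_D_def)
    then show ?thesis by (auto intro!: pointed_convex_Int)
  qed
  have signed: "positive_chain_cone ((s, 0) # map (Pair 1) [1..<n]) =
      {y. 0 \<le> s * y 0 \<and> (\<forall>i\<in>{1..<n}. 0 \<le> y i) \<and> (\<forall>i\<in>{1..<n}. s * y 0 \<le> y i) \<and> ?S y}" for s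
    by (auto simp: positive_chain_cone_def chain_cone_def form_val_def o_def)
  have wall_eq: "wall_cone n = {y. y 0 = 0 \<and> (\<forall>i\<in>{1..<n}. 0 \<le> y i) \<and> ?S y}"
    by (auto simp: wall_cone_def positive_chain_cone_def chain_cone_def form_val_def o_def)
  have D_eq: "?D = {y. \<bar>y 0\<bar> \<le> y 1 \<and> ?S y}"
    unfolding chamber_D_def chain by auto
  have pos: "?D \<inter> {y. 0 \<le> y 0} = positive_chain_cone (coords n)"
  proof -
    have "coords n = (1, 0) # map (Pair 1) [1..<n]" by (simp only: upt(1) list.map)
    then have "positive_chain_cone (coords n) = positive_chain_cone ((1, 0) # map (Pair 1) [1..<n])"
      by (simp only:)
    moreover have "(y \<in> ?D \<inter> {y. 0 \<le> y 0}) = (y \<in> positive_chain_cone ((1, 0) # map (Pair 1) [1..<n]))" for y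
      unfolding signed D_eq by (cases "?S y") (simp_all only: mem_Collect_eq Int_iff least, auto)
    ultimately show ?thesis by blast
  qed
  have "(y \<in> ?D \<inter> {y. y 0 \<le> 0}) = (y \<in> positive_chain_cone ((-1, 0) # map (Pair 1) [1..<n]))" for y
    unfolding signed D_eq by (cases "?S y") (simp_all only: mem_Collect_eq Int_iff least, auto)
  then have neg: "?D \<inter> {y. y 0 \<le> 0} = positive_chain_cone ((-1, 0) # map (Pair 1) [1..<n])"
    by blast
  have "(y \<in> ?D \<inter> {y. y 0 = 0}) = (y \<in> wall_cone n)" for y
    unfolding wall_eq D_eq by (cases "?S y") (simp_all only: mem_Collect_eq Int_iff least, auto)
  then have wall: "?D \<inter> {y. y 0 = 0} = wall_cone n" by blast
  have zero: "(\<lambda>_. 0) \<in> ?D" using D by (simp add: pointed_convex_def)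
  have "(\<Sum>C\<leftarrow>[?D, ?D \<inter> {y. y 0 = 0}]. dist2_prob n C lam) =
      (\<Sum>C\<leftarrow>[?D \<inter> {y. 0 \<le> y 0}, ?D \<inter> {y. y 0 \<le> 0}]. dist2_prob n C lam)"
    using zero dist2_cut[OF D linear_form_coord(1)[of 0] linear_form_zero]
    by (intro sum_list_dist2_prob) (auto simp: add.commute)
  moreover have "signed_permutation n ((-1, 0) # map (Pair 1) [1..<n])"
    using upt(1) by (simp add: signed_permutation_def o_def image_subset_iff)
  from dist2_prob_positive_chain_cone[OF this, of lam]
  have "dist2_prob n (?D \<inter> {y. y 0 \<le> 0}) lam = dist2_prob n (positive_chain_cone (coords n)) lam"
    by (simp add: neg)
  ultimately have rel: "dist2_prob n ?D lam = 2 * dist2_prob n (positive_chain_cone (coords n)) lam - dist2_prob n (wall_cone n) lam"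
    by (simp add: pos wall)
  obtain m where m: "n = Suc m" using n by (cases n) auto
  have fact_n: "(fact n :: real) = real n * fact (n - 1)" "(2 :: real) ^ n = 2 * 2 ^ (n - 1)"
    by (simp_all add: m)
  have "2 ^ (n - 1) * fact n * dist2_prob n ?D lam =
      2 ^ n * fact n * dist2_prob n (positive_chain_cone (coords n)) lam -
      real n * (2 ^ (n - 1) * fact (n - 1) * dist2_prob n (wall_cone n) lam)"
    unfolding rel fact_n by (simp add: algebra_simps)
  also have "\<dots> = (\<Sum>k\<le>n. real (B_num n k) * beta_kn k n lam) -
      real n * (\<Sum>k\<le>n - 1. real (B_num (n - 1) k) * beta_kn k n lam)"
    using dist2_prob_chamber_B[OF _ lam, of n] dist2_prob_wall[OF n lam] n by simp
  also have "(\<Sum>k\<le>n - 1. real (B_num (n - 1) k) * beta_kn k n lam) =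
      (\<Sum>k\<le>n. real (B_num (n - 1) k) * beta_kn k n lam)"
  proof -
    have "degree (\<Prod>i<m. [:2 * i + 1, 1:] :: nat poly) \<le> (\<Sum>i<m. degree [:2 * i + 1, 1 :: nat:])"
      by (rule order_trans[OF degree_prod_sum_le]) auto
    then have "B_num m (Suc m) = 0" unfolding B_num_def by (intro coeff_eq_0) simp
    then show ?thesis by (simp add: m)
  qed
  also have "(\<Sum>k\<le>n. real (B_num n k) * beta_kn k n lam) - real n * (\<Sum>k\<le>n. real (B_num (n - 1) k) * beta_kn k n lam) =
      (\<Sum>k\<le>n. real (D_num n k) * beta_kn k n lam)"
  proof -
    have "real (D_num n k) = real (B_num n k) - real n * real (B_num (n - 1) k)" for k
      using arg_cong[OF D_num_B_num[OF n, of k], of real_of_int] by simp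
    then show ?thesis
      by (simp only: left_diff_distrib sum_subtractf sum_distrib_left mult.assoc)
  qed
  finally show ?thesis .
qed

lemma chain_cone_coords: "chain_cone (coords n) = {y. \<forall>i. Suc i < n \<longrightarrow> y i \<le> y (Suc i)}"
  by (auto simp: chain_cone_def sorted_iff_nth_Suc form_val_def)

lemma dist_cdf_weyl_A: "dist_cdf n (weyl_A n) lam = dist2_prob n (chain_cone (coords n)) lam"
\<comment> \<open>Adding a positive multiple of the strictly increasing vector
  \<open>0, 1, ..., n - 1\<close> turns weak inequalities into strict ones.\<close>
proof (rule dist_cdf_eq_dist2_prob[where v = "\<lambda>_ i. real i"])
  show "weyl_A n \<subseteq> chain_cone (coords n)"
    by (auto simp: weyl_A_def chain_cone_coords less_imp_le)
  have perturb: "restrict (\<lambda>i. y i + e * real i) {..<n} \<in> weyl_A n"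
    if "y \<in> chain_cone (coords n)" "0 < e" for y e
    using that by (auto simp: weyl_A_def chain_cone_coords intro!: add_le_less_mono)
  then show "\<And>y e. y \<in> chain_cone (coords n) \<Longrightarrow> 0 < e \<Longrightarrow> restrict (\<lambda>i. y i + e * real i) {..<n} \<in> weyl_A n" .
  show "weyl_A n \<noteq> {}" using perturb[OF chain_cone_zero, of 1] by auto
  show "(\<lambda>i. c * y i) \<in> chain_cone (coords n)" if "y \<in> chain_cone (coords n)" "0 < c" for y c
    using that by (simp add: chain_cone_coords)
qed

lemma positive_chain_cone_coords:
  assumes "1 \<le> n"
  shows "positive_chain_cone (coords n) = {y. 0 \<le> y 0 \<and> (\<forall>i. Suc i < n \<longrightarrow> y i \<le> y (Suc i))}"
proof -
  have "0 \<le> y i" if "0 \<le> y 0" "\<forall>i. Suc i < n \<longrightarrow> y i \<le> y (Suc i)" "i < n" for y :: "nat \<Rightarrow> real" and i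
    using that(3) by (induction i) (use that(1,2) order_trans in auto)
  then show ?thesis
    using assms by (auto simp: positive_chain_cone_def chain_cone_coords form_val_def)
qed

lemma dist_cdf_weyl_B:
  assumes n: "1 \<le> n"
  shows "dist_cdf n (weyl_B n) lam = dist2_prob n (positive_chain_cone (coords n)) lam"
\<comment> \<open>The increasing vector starts at 1, so that the smallest coordinate becomes
  positive as well.\<close>
proof (rule dist_cdf_eq_dist2_prob[where v = "\<lambda>_ i. real (Suc i)"])
  show "weyl_B n \<subseteq> positive_chain_cone (coords n)"
    by (auto simp: weyl_B_def positive_chain_cone_coords[OF n] less_imp_le)
  have perturb: "restrict (\<lambda>i. y i + e * real (Suc i)) {..<n} \<in> weyl_B n"
    if "y \<in> positive_chain_cone (coords n)" "0 < e" for y e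
    using that n by (auto simp: weyl_B_def positive_chain_cone_coords[OF n]
        intro!: add_le_less_mono add_nonneg_pos)
  then show "\<And>y e. y \<in> positive_chain_cone (coords n) \<Longrightarrow> 0 < e \<Longrightarrow> restrict (\<lambda>i. y i + e * real (Suc i)) {..<n} \<in> weyl_B n" .
  show "weyl_B n \<noteq> {}" using perturb[OF positive_chain_cone_zero, of 1] by auto
  show "(\<lambda>i. c * y i) \<in> positive_chain_cone (coords n)" if "y \<in> positive_chain_cone (coords n)" "0 < c" for y c
    using that by (simp add: positive_chain_cone_coords[OF n])
qed

lemma chamber_D_eq:
  "chamber_D n = {y. \<bar>y 0\<bar> \<le> y 1 \<and> (\<forall>i. 1 \<le> i \<and> Suc i < n \<longrightarrow> y i \<le> y (Suc i))}"
proof -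
  have "(\<forall>i. Suc i < n - 1 \<longrightarrow> y (Suc i) \<le> y (Suc (Suc i))) =
      (\<forall>i. 1 \<le> i \<and> Suc i < n \<longrightarrow> y i \<le> y (Suc i))" for y :: "nat \<Rightarrow> real"
    by (auto simp: less_diff_conv) (metis Suc_le_D Suc_le_mono)
  then show ?thesis
    by (auto simp: chamber_D_def chain_cone_def sorted_iff_nth_Suc form_val_def)
qed

lemma dist_cdf_weyl_D:
  assumes n: "2 \<le> n"
  shows "dist_cdf n (weyl_D n) lam = dist2_prob n (chamber_D n) lam"
proof -
  have eq: "weyl_D n = {x \<in> PiE {..<n} (\<lambda>_. UNIV). 0 < \<bar>x 0\<bar> \<and> \<bar>x 0\<bar> < x 1 \<and>
      (\<forall>i. 1 \<le> i \<and> Suc i < n \<longrightarrow> x i < x (Suc i))}"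
    using n by (auto simp: weyl_D_def split: if_splits)
  \<comment> \<open>The coordinate \<open>y 0\<close> is pushed by 1 away from 0, on its own side,
    and \<open>y 1\<close> by 2, so that \<open>|y 0| < y 1\<close> results from the weak
    inequality.\<close>
  let ?v = "\<lambda>y i. if i = 0 then (if y 0 < (0 :: real) then -1 else 1) else real (Suc i)"
  have perturb: "restrict (\<lambda>i. y i + e * ?v y i) {..<n} \<in> weyl_D n"
    if y: "y \<in> chamber_D n" and e: "0 < e" for y e
  proof -
    have "y 0 + e * ?v y 0 \<noteq> 0" using e by auto
    moreover have "\<bar>y 0 + e * ?v y 0\<bar> < y 1 + e * ?v y 1"
      using y e by (auto simp: chamber_D_eq)
    moreover have "y i + e * ?v y i < y (Suc i) + e * ?v y (Suc i)" if "1 \<le> i" "Suc i < n" for i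
      using that y e by (intro add_le_less_mono) (auto simp: chamber_D_eq)
    ultimately show ?thesis using n by (simp add: eq)
  qed
  show ?thesis
  proof (rule dist_cdf_eq_dist2_prob[where v = ?v])
    show "weyl_D n \<subseteq> chamber_D n" by (auto simp: eq chamber_D_eq less_imp_le)
    show "restrict (\<lambda>i. y i + e * ?v y i) {..<n} \<in> weyl_D n" if "y \<in> chamber_D n" "0 < e" for y e
      by (rule perturb[OF that])
    show "weyl_D n \<noteq> {}" using perturb[of "\<lambda>_. 0" 1] by (auto simp: chamber_D_eq)
    show "(\<lambda>i. c * y i) \<in> chamber_D n" if "y \<in> chamber_D n" "0 < c" for y c
      using that by (simp add: chamber_D_eq abs_mult)
  qed
qed

theorem theorem4p2:
  fixes n k :: nat
  assumes "k \<le> n"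
  shows "(1 \<le> n \<longrightarrow> conic_intrinsic_volume n (weyl_A n) k = real (stirling n k) / fact n)
       \<and> (1 \<le> n \<longrightarrow> conic_intrinsic_volume n (weyl_B n) k = real (B_num n k) / (2^n * fact n))
       \<and> (2 \<le> n \<longrightarrow> conic_intrinsic_volume n (weyl_D n) k = real (D_num n k) / (2^(n-1) * fact n))"
proof (intro conjI impI)
  have *: "p = (\<Sum>k\<le>n. a k / c * b k)" if "c * p = (\<Sum>k\<le>n. a k * b k)" "c \<noteq> 0" for a b :: "nat \<Rightarrow> real" and c p
    using that by (simp add: sum_divide_distrib[symmetric] field_simps)
  show "conic_intrinsic_volume n (weyl_A n) k = real (stirling n k) / fact n" if n: "1 \<le> n"
    using n assms
  proof (rule conic_intrinsic_volume_eqI)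
    fix lam :: real assume "0 \<le> lam"
    from dist2_prob_chamber_A[OF n this]
    show "dist_cdf n (weyl_A n) lam = (\<Sum>k\<le>n. real (stirling n k) / fact n * beta_kn k n lam)"
      unfolding dist_cdf_weyl_A by (rule *) simp
  qed
  show "conic_intrinsic_volume n (weyl_B n) k = real (B_num n k) / (2^n * fact n)" if n: "1 \<le> n"
    using n assms
  proof (rule conic_intrinsic_volume_eqI)
    fix lam :: real assume "0 \<le> lam"
    from dist2_prob_chamber_B[OF n this]
    show "dist_cdf n (weyl_B n) lam = (\<Sum>k\<le>n. real (B_num n k) / (2^n * fact n) * beta_kn k n lam)"
      unfolding dist_cdf_weyl_B[OF n] by (rule *) simp
  qed
  show "conic_intrinsic_volume n (weyl_D n) k = real (D_num n k) / (2^(n-1) * fact n)" if n: "2 \<le> n"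
    using _ assms
  proof (rule conic_intrinsic_volume_eqI)
    show "1 \<le> n" using n by simp
    fix lam :: real assume "0 \<le> lam"
    from dist2_prob_chamber_D[OF n this]
    show "dist_cdf n (weyl_D n) lam = (\<Sum>k\<le>n. real (D_num n k) / (2^(n-1) * fact n) * beta_kn k n lam)"
      unfolding dist_cdf_weyl_D[OF n] by (rule *) simp
  qed
qed

end
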